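(* Let $d\in\mathbb{N}$. For any $R,M>0$, any $f\in\mathcal B_R$ (that is, $f:\mathbb{R}^d\to\mathbb{R}$ continuous and Lebesgue-integrable with $L^1[\widehat f]:=\int_{\mathbb{R}^d}|\widehat f(\boldsymbol\xi)|\,d\boldsymbol\xi\le R$ and $\|f\|_{\mathcal B_2}:=\left(\int_{\mathbb{R}^d}\|\boldsymbol\xi\|^2|\widehat f(\boldsymbol\xi)|\,d\boldsymbol\xi\right)^{1/2}<\infty$) and any $n\in\mathbb{N}$, there exists $\boldsymbol\theta\in\boldsymbol\Theta=(\mathbb{R}^d\times\mathbb{R}\times[0,2\pi])^n$ such that the quantum neural network $f^R_{n,\boldsymbol\theta}$ (defined in the context) satisfies $$\sup_{\boldsymbol x\in[-M,M]^d}\left|f(\boldsymbol x)-f^R_{n,\boldsymbol\theta}(\boldsymbol x)\right|\le\frac{2(\pi+1)L^1[\widehat f]+8\pi M d^{1/2}\,L^1[\widehat f]^{1/2}\,\|f\|_{\mathcal B_2}}{\sqrt n}.$$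
   Context: Fourier transform: $\widehat f(\boldsymbol\xi)=\int_{\mathbb{R}^d}e^{-2\pi \mathrm{i}\,\boldsymbol y\cdot\boldsymbol\xi}f(\boldsymbol y)\,d\boldsymbol y$; $\|\cdot\|$ is the Euclidean norm. Quantum circuit. Let $n\in\mathbb{N}$, $\boldsymbol\theta=(\boldsymbol a^i,b^i,\gamma^i)_{i=1,\dots,n}\in\boldsymbol\Theta=(\mathbb{R}^d\times\mathbb{R}\times[0,2\pi])^n$, $\boldsymbol x\in\mathbb{R}^d$. Let $\mathtt H=\frac1{\sqrt2}\begin{pmatrix}1&1\\1&-1\end{pmatrix}$, $\mathtt R_y(\gamma)=\begin{pmatrix}\cos(\gamma/2)&-\sin(\gamma/2)\\ \sin(\gamma/2)&\cos(\gamma/2)\end{pmatrix}$, $\mathtt R_z(\alpha)=\begin{pmatrix}e^{-\mathrm i\alpha/2}&0\\0&e^{\mathrm i\alpha/2}\end{pmatrix}$. For $i=1,\dots,n$ put $\mathtt U_1^{(i)}=\mathtt H\,\mathtt R_z(-b^i)\,\mathtt R_z(-a^i_dx_d)\cdots\mathtt R_z(-a^i_1x_1)\,\mathtt H$, $\mathtt U_2^{(i)}=\mathtt R_y(\gamma^i)$, and $\bar{\mathtt U}^{(i)}=\mathtt U_1^{(i)}\otimes\mathtt U_2^{(i)}\in\mathbb{C}^{4\times4}$ (Kronecker product). Let $n_0\ge0$ be the smallest integer with $\log_2(4n+n_0)\in\mathbb{N}$, $\mathfrak n=\lceil\log_2(4n)\rceil$, $N=4n+n_0=2^{\mathfrak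 n}$, and let $\mathtt U(\boldsymbol\theta,\boldsymbol x)\in\mathbb{C}^{N\times N}$ be the block-diagonal unitary matrix with diagonal blocks $\bar{\mathtt U}^{(1)},\dots,\bar{\mathtt U}^{(n)}$ and the $n_0\times n_0$ identity. Denote by $|0\rangle,\dots,|N-1\rangle$ the computational (standard) basis of $\mathbb{C}^N$, with $|0\rangle=|0\rangle^{\otimes\mathfrak n}$, and let $\mathtt V\in\mathbb{C}^{N\times N}$ be any unitary matrix mapping $|0\rangle^{\otimes\mathfrak n}$ to $|\psi\rangle=\frac1{\sqrt n}\sum_{i=0}^{n-1}|4i\rangle$. The circuit is $\mathtt C_{\mathfrak n}(\boldsymbol\theta,\boldsymbol x)=\mathtt U(\boldsymbol\theta,\boldsymbol x)\mathtt V$. For $m\in\{0,1,2,3\}$, $\mathbb{P}^n_m(\boldsymbol\theta,\boldsymbol x)$ is the probability that measuring $\mathtt C_{\mathfrak n}(\boldsymbol\theta,\boldsymbol x)|0\rangle^{\otimes\mathfrak n}$ in the computational basis gives an outcome in $\{m,4+m,\dots,4(n-1)+m\}$, i.e. $\mathbb{P}^n_m=\sum_{i=0}^{n-1}|\langle 4i+m|\mathtt U\mathtt V|0\rangle^{\otimes\mathfrak n}|^2$. For $R>0$, the quantum neural network is $$f^R_{n,\boldsymbol\theta}(\boldsymbol x)=R-2R\left[\mathbb{P}^n_1(\boldsymbol\theta,\boldsymbol x)+\mathbb{P}^n_2(\boldsymbol\theta,\boldsymbol x)\right].$$ *)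

theory Defs
  imports "HOL-Analysis.Analysis" "Jordan_Normal_Form.Schur_Decomposition"
begin

section \<open>Fourier transform and the function class\<close>

definition fourier :: "(real ^ 'd \<Rightarrow> real) \<Rightarrow> real ^ 'd \<Rightarrow> complex" where
  "fourier f \<xi> = (LINT y|lborel. exp (- (2 * of_real pi * \<i> * of_real (inner y \<xi>))) * of_real (f y))"

definition fourier_L1 :: "(real ^ 'd \<Rightarrow> real) \<Rightarrow> real" where
  "fourier_L1 f = (LINT \<xi>|lborel. cmod (fourier f \<xi>))"

definition norm_B2 :: "(real ^ 'd \<Rightarrow> real) \<Rightarrow> real" where
  "norm_B2 f = sqrt (LINT \<xi>|lborel. (norm \<xi>)\<^sup>2 * cmod (fourier f \<xi>))"

text \<open>The Bochner integral of a non-integrable function is \<open>0\<close>, so finiteness of the integrals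
  defining \<^const>\<open>fourier_L1\<close> and \<^const>\<open>norm_B2\<close> is expressed by integrability.\<close>

definition barron_class :: "real \<Rightarrow> (real ^ 'd \<Rightarrow> real) set" where
  "barron_class R = {f. continuous_on UNIV f \<and> integrable lborel f \<and>
     integrable lborel (\<lambda>\<xi>. cmod (fourier f \<xi>)) \<and> fourier_L1 f \<le> R \<and>
     integrable lborel (\<lambda>\<xi>. (norm \<xi>)\<^sup>2 * cmod (fourier f \<xi>))}"


section \<open>Gates\<close>

definition hadamard :: "complex mat" where
  "hadamard = of_real (1 / sqrt 2) \<cdot>\<^sub>m mat_of_rows_list 2 [[1, 1], [1, -1]]"

definition rot_y :: "real \<Rightarrow> complex mat" where
  "rot_y \<gamma> = mat_of_rows_list 2
     [[of_real (cos (\<gamma> / 2)), - of_real (sin (\<gamma> / 2))],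
      [of_real (sin (\<gamma> / 2)), of_real (cos (\<gamma> / 2))]]"

definition rot_z :: "real \<Rightarrow> complex mat" where
  "rot_z \<alpha> = mat_of_rows_list 2
     [[exp (- (\<i> * of_real \<alpha> / 2)), 0],
      [0, exp (\<i> * of_real \<alpha> / 2)]]"

definition kronecker :: "complex mat \<Rightarrow> complex mat \<Rightarrow> complex mat" where
  "kronecker A B = Matrix.mat (dim_row A * dim_row B) (dim_col A * dim_col B)
     (\<lambda>(i, j). A $$ (i div dim_row B, j div dim_col B) * B $$ (i mod dim_row B, j mod dim_col B))"

definition unitary_mat :: "nat \<Rightarrow> complex mat \<Rightarrow> bool" where
  "unitary_mat N A \<longleftrightarrow> A \<in> carrier_mat N N \<and>
     A * mat_adjoint A = 1\<^sub>m N \<and> mat_adjoint A * A = 1\<^sub>m N"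


section \<open>The circuit\<close>

text \<open>A parameter \<open>\<theta>\<close> is a list of \<open>n\<close> triples \<open>(a, b, \<gamma>)\<close>; list positions start at \<open>0\<close>.
  The linear order on the index type \<open>'d\<close> fixes the order of the coordinates, and
  hence of the factors \<open>R\<^sub>z(- a\<^sub>d x\<^sub>d) \<cdots> R\<^sub>z(- a\<^sub>1 x\<^sub>1)\<close>. Every dimension \<open>d \<ge> 1\<close> is covered,
  since the numeral types are instances of \<^class>\<open>finite\<close> and \<^class>\<open>linorder\<close>.\<close>

type_synonym 'd param = "((real ^ 'd) \<times> real \<times> real) list"

definition Theta :: "nat \<Rightarrow> ('d::finite) param set" where
  "Theta n = {\<theta>. length \<theta> = n \<and> set \<theta> \<subseteq> UNIV \<times> UNIV \<times> {0..2 * pi}}"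

definition gate_U1 ::
  "real ^ 'd::{finite,linorder} \<Rightarrow> real \<Rightarrow> real ^ 'd::{finite,linorder} \<Rightarrow> complex mat" where
  "gate_U1 a b x = hadamard * rot_z (- b) *
     foldr (*) (map (\<lambda>j. rot_z (- (vec_nth a j * vec_nth x j)))
                  (rev (sorted_list_of_set UNIV))) (1\<^sub>m 2) * hadamard"

definition block_U ::
  "real ^ 'd::{finite,linorder} \<Rightarrow> (real ^ 'd::{finite,linorder}) \<times> real \<times> real \<Rightarrow> complex mat" where
  "block_U x = (\<lambda>(a, b, \<gamma>). kronecker (gate_U1 a b x) (rot_y \<gamma>))"

definition pad :: "nat \<Rightarrow> nat" where
  "pad n = (LEAST n0. log 2 (real (4 * n + n0)) \<in> \<nat>)"

definition qubits :: "nat \<Rightarrow> nat" where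
  "qubits n = nat \<lceil>log 2 (real (4 * n))\<rceil>"

definition qdim :: "nat \<Rightarrow> nat" where
  "qdim n = 4 * n + pad n"

lemma qdim_eq_power:
  assumes "n \<ge> 1"
  shows "qdim n = 2 ^ qubits n"
proof -
  have log_Nats: "log 2 (real k) \<in> \<nat> \<longleftrightarrow> (\<exists>m. k = 2 ^ m)" if "k > 0" for k :: nat
  proof
    assume "log 2 (real k) \<in> \<nat>"
    then obtain m where "log 2 (real k) = real m"
      by (auto elim: Nats_cases)
    then have "real k = 2 powr real m"
      using that by (metis log_powr_cancel of_nat_0_less_iff powr_log_cancel
          zero_less_numeral numeral_eq_one_iff semiring_norm(85))
    then have "real k = real (2 ^ m)"
      by (simp add: powr_realpow)
    then show "\<exists>m. k = 2 ^ m"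
      by (metis of_nat_eq_iff)
  next
    assume "\<exists>m. k = 2 ^ m"
    then show "log 2 (real k) \<in> \<nat>"
      by (auto simp: log_nat_power)
  qed
  define c where "c = qubits n"
  have pos: "0 \<le> log 2 (real (4 * n))"
    using assms by (subst zero_le_log_cancel_iff) auto
  have c_int: "int c = \<lceil>log 2 (real (4 * n))\<rceil>"
    unfolding c_def qubits_def using pos by simp
  have le: "4 * n \<le> 2 ^ m \<longleftrightarrow> c \<le> m" for m
  proof -
    have "4 * n \<le> 2 ^ m \<longleftrightarrow> real (4 * n) \<le> 2 powr real m"
      by (simp add: powr_realpow flip: of_nat_le_iff[where 'a = real])
    also have "\<dots> \<longleftrightarrow> log 2 (real (4 * n)) \<le> real m"
      using assms by (subst log_le_iff) auto
    also have "\<dots> \<longleftrightarrow> int c \<le> int m"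
      unfolding c_int by (simp add: ceiling_le_iff)
    finally show ?thesis by simp
  qed
  have "pad n = 2 ^ c - 4 * n"
    unfolding pad_def
  proof (rule Least_equality)
    show "log 2 (real (4 * n + (2 ^ c - 4 * n))) \<in> \<nat>"
      using le[of c] assms by (subst log_Nats) auto
  next
    fix y
    assume "log 2 (real (4 * n + y)) \<in> \<nat>"
    then obtain m where m: "4 * n + y = 2 ^ m"
      using assms log_Nats[of "4 * n + y"] by auto
    then have "c \<le> m"
      using le[of m] by simp
    then have "(2::nat) ^ c \<le> 2 ^ m"
      by (simp add: power_increasing)
    then show "2 ^ c - 4 * n \<le> y"
      using m by linarith
  qed
  then show ?thesis
    using le[of c] by (simp add: qdim_def c_def)
qed

definition circuit_U :: "('d::{finite,linorder}) param \<Rightarrow> real ^ 'd::{finite,linorder} \<Rightarrow> complex mat" where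
  "circuit_U \<theta> x = diag_block_mat (map (block_U x) \<theta> @ [1\<^sub>m (pad (length \<theta>))])"

abbreviation ket :: "nat \<Rightarrow> nat \<Rightarrow> complex Matrix.vec" where
  "ket N k \<equiv> unit_vec N k"

text \<open>\<open>|\<psi>\<rangle>\<close>: the sum \<open>\<Sum>i<n. |4i\<rangle>\<close> written componentwise, since Jordan_Normal_Form vectors
  have no zero independent of the dimension.\<close>

definition psi :: "nat \<Rightarrow> complex Matrix.vec" where
  "psi n = of_real (1 / sqrt (real n)) \<cdot>\<^sub>v
     Matrix.vec (qdim n) (\<lambda>k. \<Sum>i<n. vec_index (ket (qdim n) (4 * i)) k)"

definition preparation :: "nat \<Rightarrow> complex mat \<Rightarrow> bool" where
  "preparation n V \<longleftrightarrow> unitary_mat (qdim n) V \<and> V *\<^sub>v ket (qdim n) 0 = psi n"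

text \<open>The network depends on \<open>V\<close>, which is an explicit parameter. As \<open>w \<bullet>c v\<close> is conjugate-linear
  in \<open>v\<close>, the amplitude \<open>\<langle>k|w\<rangle>\<close> is \<open>w \<bullet>c ket N k\<close>.\<close>

definition prob ::
  "nat \<Rightarrow> complex mat \<Rightarrow> ('d::{finite,linorder}) param \<Rightarrow> real ^ 'd::{finite,linorder} \<Rightarrow> nat \<Rightarrow> real" where
  "prob n V \<theta> x m =
     (\<Sum>i<n. (cmod (((circuit_U \<theta> x * V) *\<^sub>v ket (qdim n) 0) \<bullet>c ket (qdim n) (4 * i + m)))\<^sup>2)"

definition qnn ::
  "real \<Rightarrow> nat \<Rightarrow> complex mat \<Rightarrow> ('d::{finite,linorder}) param \<Rightarrow> real ^ 'd::{finite,linorder} \<Rightarrow> real" where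
  "qnn R n V \<theta> x = R - 2 * R * (prob n V \<theta> x 1 + prob n V \<theta> x 2)"

end

theory Submission
  imports Defs "HOL-Probability.Probability"
begin

text \<open>The circuit evaluates to \<open>(R / n) (\<Sum>i. cos \<gamma>\<^sub>i cos (b\<^sub>i + \<langle>a\<^sub>i, x\<rangle>))\<close>. By Fourier inversion, \<open>f\<close> is
  \<open>fourier_L1 f\<close> times the mean of the random wave \<open>cos (2 \<pi> \<langle>\<xi>, x\<rangle> + arg (fourier f \<xi>))\<close>, where \<open>\<xi>\<close>
  has density proportional to \<open>\<bar>fourier f\<bar>\<close>. So it suffices to find \<open>n\<close> samples whose average is
  uniformly close to the mean. The deviation at \<open>0\<close> has variance at most \<open>1 / n\<close>; its oscillation
  over the cube is controlled by symmetrisation and the contraction principle for the 1-Lipschitz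
  function \<open>cos\<close>, which replace the waves by the linear functions \<open>\<epsilon>\<^sub>i \<langle>\<xi>\<^sub>i, x\<rangle>\<close> with random signs.
  Taking the deviation at \<open>0\<close> apart gives \<open>1\<close> in place of the constant \<open>2 (\<pi> + 1)\<close>.\<close>

section \<open>Fourier inversion\<close>

text \<open>The supremum over an uncountable cube of a sum of independent random functions is
  awkward as a random variable on a product space. No such variable is formed: functionals
  \<open>A\<close> act on bounded functions, the supremum is the first of them, and one sample at a
  time is integrated out by passing from \<open>A\<close> to \<open>sign_avg A\<close>. What each
  step needs is isolated in four properties (\<open>lip\<close>, \<open>contracting\<close>,
  \<open>midconvex\<close>, \<open>jensen\<close>), which hold for the supremum and survive
  \<open>sign_avg\<close>. The constant 8 pi has three sources: 2 from symmetrisation, 2 from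
  controlling \<open>h\<close> and \<open>- h\<close> separately, and 2 pi from the phase of the
  Fourier kernel. With L = \<open>fourier_L1 f\<close>, the sampled frequencies \<xi> have second
  moment \<open>norm_B2 f\<close> squared over L; multiplying its root by L leaves the factor sqrt
  L. The angle arccos (L / R) turns the amplitude R of the circuit into L, which is where L \<le> R
  enters and why R is absent from the error bound.\<close>

lemma lborel_prod_Basis:
  fixes f :: "'a::euclidean_space \<Rightarrow> real \<Rightarrow> complex"
  assumes f: "\<And>b. b \<in> Basis \<Longrightarrow> integrable lborel (f b)"
  shows integrable_lborel_prod_Basis: "integrable lborel (\<lambda>x. \<Prod>b\<in>Basis. f b (inner x b))"
    and integral_lborel_prod_Basis:
      "(LINT x|lborel. (\<Prod>b\<in>Basis. f b (inner x b))) = (\<Prod>b\<in>Basis. (LINT t|lborel. f b t))"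
proof -
  interpret P: product_sigma_finite "\<lambda>b::'a. lborel :: real measure"
    by standard
  \<comment> \<open>\<open>lborel\<close> is the image of the product of one-dimensional Lebesgue
    measures under this map, so both claims reduce to integrals of products over a product
    space.\<close>
  have T[measurable]: "(\<lambda>g. \<Sum>b\<in>Basis. g b *\<^sub>R b) \<in> (\<Pi>\<^sub>M b\<in>(Basis::'a set). lborel) \<rightarrow>\<^sub>M (borel :: 'a measure)"
    by measurable
  have [measurable]: "f b \<in> borel_measurable borel" if "b \<in> Basis" for b
    using f[OF that] by (auto dest: borel_measurable_integrable)
  have F[measurable]: "(\<lambda>x. \<Prod>b\<in>Basis. f b (inner x b)) \<in> borel_measurable borel"
    by measurable
  have eq: "(\<Prod>b\<in>Basis. f b (inner (\<Sum>c\<in>Basis. g c *\<^sub>R c) b)) = (\<Prod>b\<in>Basis. f b (g b))" for g :: "'a \<Rightarrow> real"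
    by (intro prod.cong) (auto simp: inner_sum_left inner_Basis if_distrib cong: if_cong)
  show "integrable lborel (\<lambda>x. \<Prod>b\<in>Basis. f b (inner x b))"
    unfolding lborel_eq[where 'a='a] using P.product_integrable_prod[of Basis f] f
    by (subst integrable_distr_eq) (auto simp: eq)
  show "(LINT x|lborel. (\<Prod>b\<in>Basis. f b (inner x b))) = (\<Prod>b\<in>Basis. (LINT t|lborel. f b t))"
    unfolding lborel_eq[where 'a='a] using P.product_integral_prod[of Basis f] f
    by (subst integral_distr) (auto simp: eq lborel_eq[symmetric, where 'a=real] simp del: sum_of_bool_eq)
qed

text \<open>The substitution t = T u turns the integral into the characteristic function of the
  standard normal law at a T.\<close>

lemma gaussian_real:
  fixes a T :: real
  assumes T: "T > 0"
  shows integrable_gaussian_real: "integrable lborel (\<lambda>t. cis (a * t) * of_real (exp (- t\<^sup>2 / (2 * T\<^sup>2))))"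
    and integral_gaussian_real: "(LINT t|lborel. cis (a * t) * of_real (exp (- t\<^sup>2 / (2 * T\<^sup>2))))
      = of_real (T * sqrt (2 * pi) * exp (- (a * T)\<^sup>2 / 2))"
proof -
  have nd: "normal_density 0 T t = exp (- t\<^sup>2 / (2 * T\<^sup>2)) / (T * sqrt (2 * pi))" for t
    using T by (simp add: normal_density_def real_sqrt_mult)
  have exp_nd: "exp (- t\<^sup>2 / (2 * T\<^sup>2)) = T * sqrt (2 * pi) * normal_density 0 T t" for t
    using T by (simp add: nd)
  have "integrable lborel (normal_density 0 T)"
    using T by simp
  then have i: "integrable lborel (\<lambda>t. exp (- t\<^sup>2 / (2 * T\<^sup>2)))"
    unfolding exp_nd by simp
  show int: "integrable lborel (\<lambda>t. cis (a * t) * of_real (exp (- t\<^sup>2 / (2 * T\<^sup>2))))"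
    by (rule Bochner_Integration.integrable_bound[OF i])
      (auto simp: norm_mult cis_conv_exp)
  have "of_real (exp (- (a * T)\<^sup>2 / 2)) = char std_normal_distribution (a * T)"
    by (simp add: char_std_normal_distribution)
  also have "\<dots> = (LINT t|lborel. std_normal_density t *\<^sub>R cis (a * T * t))"
    unfolding char_def cis_conv_exp
    by (subst integral_density) (auto simp: mult_ac)
  finally have e1: "(LINT t|lborel. std_normal_density t *\<^sub>R cis (a * T * t)) = of_real (exp (- (a * T)\<^sup>2 / 2))"
    by simp
  have "(LINT t|lborel. cis (a * t) * of_real (exp (- t\<^sup>2 / (2 * T\<^sup>2)))) =
     \<bar>T\<bar> *\<^sub>R (LINT t|lborel. cis (a * (0 + T * t)) * of_real (exp (- (0 + T * t)\<^sup>2 / (2 * T\<^sup>2))))"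
    using T by (intro lborel_integral_real_affine) auto
  also have "(\<lambda>t. cis (a * (0 + T * t)) * of_real (exp (- (0 + T * t)\<^sup>2 / (2 * T\<^sup>2)))) =
     (\<lambda>t. of_real (sqrt (2 * pi)) * (std_normal_density t *\<^sub>R cis (a * T * t)))"
    using T by (auto simp: std_normal_density_def power_mult_distrib scaleR_conv_of_real mult_ac simp del: of_real_exp)
  also have "\<bar>T\<bar> *\<^sub>R (LINT t|lborel. \<dots> t) = of_real (T * sqrt (2 * pi) * exp (- (a * T)\<^sup>2 / 2))"
    using T by (subst integral_mult_right_zero, subst e1) (auto simp: scaleR_conv_of_real)
  finally show "(LINT t|lborel. cis (a * t) * of_real (exp (- t\<^sup>2 / (2 * T\<^sup>2))))
      = of_real (T * sqrt (2 * pi) * exp (- (a * T)\<^sup>2 / 2))" .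
qed

text \<open>Both the character and the Gaussian factor over the coordinates, which leaves
  one-dimensional integrals.\<close>

lemma gaussian_euclidean:
  fixes z :: "'a::euclidean_space"
  assumes T: "T > 0"
  shows integrable_gaussian: "integrable lborel (\<lambda>x. cis (inner z x) * of_real (exp (- (norm x)\<^sup>2 / (2 * T\<^sup>2))))"
    and integral_gaussian: "(LINT x|lborel. cis (inner z x) * of_real (exp (- (norm x)\<^sup>2 / (2 * T\<^sup>2))))
      = of_real ((T * sqrt (2 * pi)) ^ DIM('a) * exp (- (T * norm z)\<^sup>2 / 2))"
proof -
  define F where "F = (\<lambda>(b::'a) t. cis (inner z b * t) * of_real (exp (- t\<^sup>2 / (2 * T\<^sup>2))) :: complex)"
  have cis_sum: "cis (\<Sum>b\<in>B. u b) = (\<Prod>b\<in>B. cis (u b))" if "finite B" for u and B :: "'a set"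
    using that by induct (auto simp: cis_mult[symmetric])
  have nsq: "(norm x)\<^sup>2 = (\<Sum>b\<in>Basis. (inner x b)\<^sup>2)" for x :: 'a
    unfolding power2_norm_eq_inner by (subst euclidean_inner) (simp add: power2_eq_square)
  have F: "cis (inner z x) * of_real (exp (- (norm x)\<^sup>2 / (2 * T\<^sup>2))) = (\<Prod>b\<in>Basis. F b (inner x b))" for x
  proof -
    have "(\<Prod>b\<in>Basis. F b (inner x b)) = (\<Prod>b\<in>Basis. cis (inner z b * inner x b)) *
        of_real (\<Prod>b\<in>Basis. exp (- (inner x b)\<^sup>2 / (2 * T\<^sup>2)))"
      unfolding F_def prod.distrib of_real_prod ..
    also have "\<dots> = cis (inner z x) * of_real (exp (- (norm x)\<^sup>2 / (2 * T\<^sup>2)))"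
      by (simp only: cis_sum[symmetric] exp_sum[symmetric] finite_Basis euclidean_inner[of z x, symmetric] nsq
         sum_divide_distrib[symmetric] sum_negf[symmetric])
    finally show ?thesis ..
  qed
  have iF: "integrable lborel (F b)" for b
    unfolding F_def using T by (rule integrable_gaussian_real)
  show "integrable lborel (\<lambda>x. cis (inner z x) * of_real (exp (- (norm x)\<^sup>2 / (2 * T\<^sup>2))))"
    unfolding F by (rule integrable_lborel_prod_Basis[OF iF])
  have "(LINT x|lborel. cis (inner z x) * of_real (exp (- (norm x)\<^sup>2 / (2 * T\<^sup>2))))
     = (\<Prod>b\<in>Basis. (LINT t|lborel. F b t))"
    unfolding F by (rule integral_lborel_prod_Basis[OF iF])
  also have "\<dots> = (\<Prod>b\<in>(Basis::'a set). of_real (T * sqrt (2 * pi) * exp (- (inner z b * T)\<^sup>2 / 2)))"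
    unfolding F_def using T by (simp only: integral_gaussian_real)
  also have "\<dots> = of_real (\<Prod>b\<in>(Basis::'a set). (T * sqrt (2 * pi)) * exp (- (inner z b * T)\<^sup>2 / 2))"
    by (simp only: of_real_prod)
  also have "(\<Prod>b\<in>(Basis::'a set). (T * sqrt (2 * pi)) * exp (- (inner z b * T)\<^sup>2 / 2))
     = (T * sqrt (2 * pi)) ^ DIM('a) * exp (\<Sum>b\<in>(Basis::'a set). - (inner z b * T)\<^sup>2 / 2)"
    by (simp only: prod.distrib prod_constant power_mult_distrib exp_sum[symmetric] finite_Basis)
  also have "(\<Sum>b\<in>(Basis::'a set). - (inner z b * T)\<^sup>2 / 2) = - (T * norm z)\<^sup>2 / 2"
    by (simp add: power_mult_distrib nsq sum_distrib_left sum_divide_distrib sum_negf mult_ac)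
  finally show "(LINT x|lborel. cis (inner z x) * of_real (exp (- (norm x)\<^sup>2 / (2 * T\<^sup>2))))
      = of_real ((T * sqrt (2 * pi)) ^ DIM('a) * exp (- (T * norm z)\<^sup>2 / 2))" .
qed

text \<open>The Fourier transform of the regulariser exp (- |\<xi>|^2 / (2 T^2)). It is also the
  density of a centred normal law with standard deviation 1 / (2 pi T) in each coordinate, hence
  concentrates at 0 as T grows.\<close>

definition gauss_kernel :: "real \<Rightarrow> 'a::euclidean_space \<Rightarrow> real" where
  "gauss_kernel T z = (T * sqrt (2 * pi)) ^ DIM('a) * exp (- (T * (2 * pi * norm z))\<^sup>2 / 2)"

text \<open>The Gaussian factor makes the double integrand absolutely integrable, with modulus |f y|
  G \<xi>, so Fubini applies; the inner integral over \<xi> is then an explicit Gaussian transform.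
  Without the factor the modulus would be constant in \<xi>.\<close>

lemma gaussian_regularised_inversion:
  fixes f :: "'a::euclidean_space \<Rightarrow> real"
  assumes f: "integrable lborel f" and T: "T > 0"
  shows "(LINT \<xi>|lborel. cis (2 * pi * inner x \<xi>) *
            (LINT y|lborel. cis (- (2 * pi * inner y \<xi>)) * of_real (f y)) *
            of_real (exp (- (norm \<xi>)\<^sup>2 / (2 * T\<^sup>2))))
     = of_real (LINT y|lborel. f y * gauss_kernel T (x - y))"
proof -
  define G where "G = (\<lambda>\<xi>::'a. exp (- (norm \<xi>)\<^sup>2 / (2 * T\<^sup>2)))"
  have [measurable]: "f \<in> borel_measurable borel" "G \<in> borel_measurable borel"
    using f unfolding G_def by (auto dest: borel_measurable_integrable)
  have iG: "integrable lborel G"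
    using integrable_norm[OF integrable_gaussian[OF T, of "0::'a"]]
    by (simp add: G_def norm_mult)
  define H where "H = (\<lambda>\<xi> y. cis (2 * pi * inner (x - y) \<xi>) * of_real (f y) * of_real (G \<xi>))"
  have nH: "norm (H \<xi> y) = \<bar>f y\<bar> * G \<xi>" for \<xi> y
    by (simp add: H_def norm_mult G_def)
  have Hm[measurable]: "case_prod H \<in> borel_measurable (lborel \<Otimes>\<^sub>M lborel)"
    unfolding H_def cis_conv_exp by measurable
  have iH: "integrable (lborel \<Otimes>\<^sub>M lborel) (case_prod H)"
  proof (rule lborel_pair.Fubini_integrable)
    show "integrable lborel (\<lambda>\<xi>. LINT y|lborel. norm (case (\<xi>, y) of (\<xi>, y) \<Rightarrow> H \<xi> y))"
      using iG by (simp add: nH)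
    show "AE \<xi> in lborel. integrable lborel (\<lambda>y. case (\<xi>, y) of (\<xi>, y) \<Rightarrow> H \<xi> y)"
    proof (intro AE_I2, simp)
      fix \<xi>
      have "integrable lborel (\<lambda>y. \<bar>f y\<bar> * G \<xi>)"
        using f by simp
      moreover have "H \<xi> \<in> borel_measurable lborel"
        unfolding H_def cis_conv_exp by measurable
      ultimately show "integrable lborel (H \<xi>)"
        by (rule Bochner_Integration.integrable_bound) (auto simp: nH)
    qed
  qed fact
  have "(LINT \<xi>|lborel. cis (2 * pi * inner x \<xi>) *
            (LINT y|lborel. cis (- (2 * pi * inner y \<xi>)) * of_real (f y)) * of_real (G \<xi>))
     = (LINT \<xi>|lborel. (LINT y|lborel. H \<xi> y))"
  proof (rule Bochner_Integration.integral_cong[OF refl])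
    fix \<xi>
    have "H \<xi> y = cis (2 * pi * inner x \<xi>) * of_real (G \<xi>) * (cis (- (2 * pi * inner y \<xi>)) * of_real (f y))" for y
    proof -
      have "cis (2 * pi * inner (x - y) \<xi>) = cis (2 * pi * inner x \<xi>) * cis (- (2 * pi * inner y \<xi>))"
        by (simp add: cis_mult inner_diff_left algebra_simps)
      then show ?thesis
        by (simp only: H_def mult_ac)
    qed
    then show "cis (2 * pi * inner x \<xi>) *
            (LINT y|lborel. cis (- (2 * pi * inner y \<xi>)) * of_real (f y)) * of_real (G \<xi>) = (LINT y|lborel. H \<xi> y)"
      by simp
  qed
  also have "\<dots> = (LINT y|lborel. (LINT \<xi>|lborel. H \<xi> y))"
    using lborel_pair.Fubini_integral[OF iH] by simp
  also have "\<dots> = (LINT y|lborel. of_real (f y * ((T * sqrt (2 * pi)) ^ DIM('a) * exp (- (T * (2 * pi * norm (x - y)))\<^sup>2 / 2))))"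
  proof (rule Bochner_Integration.integral_cong[OF refl])
    fix y
    have "H \<xi> y = of_real (f y) * (cis (inner ((2 * pi) *\<^sub>R (x - y)) \<xi>) * of_real (exp (- (norm \<xi>)\<^sup>2 / (2 * T\<^sup>2))))" for \<xi>
      by (simp add: H_def G_def mult_ac)
    then have "(LINT \<xi>|lborel. H \<xi> y) = of_real (f y) *
        of_real ((T * sqrt (2 * pi)) ^ DIM('a) * exp (- (T * norm ((2 * pi) *\<^sub>R (x - y)))\<^sup>2 / 2))"
      by (simp only: integral_mult_right_zero integral_gaussian[OF T])
    then show "(LINT \<xi>|lborel. H \<xi> y) = of_real (f y * ((T * sqrt (2 * pi)) ^ DIM('a) * exp (- (T * (2 * pi * norm (x - y)))\<^sup>2 / 2)))"
      by simp
  qed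
  finally show ?thesis
    unfolding G_def integral_complex_of_real gauss_kernel_def .
qed

text \<open>For S = 1 / (2 pi T) the kernel is a multiple of the Gaussian of width S, so the
  transform at frequency 0 gives its mass, and the normalising factors cancel because T S 2 pi = 1.
  Evenness and translation invariance of \<open>lborel\<close> then replace z by x - y.\<close>

lemma gauss_kernel:
  fixes x :: "'a::euclidean_space"
  assumes T: "T > 0"
  shows integrable_gauss_kernel: "integrable lborel (\<lambda>y. gauss_kernel T (x - y))"
    and integral_gauss_kernel: "(LINT y|lborel. gauss_kernel T (x - y)) = 1"
proof -
  define S where "S = 1 / (2 * pi * T)"
  have S: "S > 0" using T by (simp add: S_def)
  have k: "gauss_kernel T z = (T * sqrt (2 * pi)) ^ DIM('a) * exp (- (norm z)\<^sup>2 / (2 * S\<^sup>2))" for z :: 'a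
    using T by (simp add: gauss_kernel_def S_def power_divide power_mult_distrib divide_simps)
  have c: "complex_of_real (gauss_kernel T z) = of_real ((T * sqrt (2 * pi)) ^ DIM('a)) *
      (cis (inner 0 z) * of_real (exp (- (norm z)\<^sup>2 / (2 * S\<^sup>2))))" for z :: 'a
    by (simp add: k)
  have "integrable lborel (\<lambda>z::'a. complex_of_real (gauss_kernel T z))"
    unfolding c by (intro integrable_mult_right integrable_gaussian S)
  then have i: "integrable lborel (gauss_kernel T :: 'a \<Rightarrow> real)"
    using integrable_Re by fastforce
  have "complex_of_real (LINT z|lborel. gauss_kernel T (z::'a)) = of_real ((T * sqrt (2 * pi)) ^ DIM('a)) *
     of_real ((S * sqrt (2 * pi)) ^ DIM('a) * exp (- (S * norm (0::'a))\<^sup>2 / 2))"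
    unfolding integral_complex_of_real[symmetric] c integral_mult_right_zero integral_gaussian[OF S] ..
  also have "\<dots> = of_real (((T * sqrt (2 * pi)) * (S * sqrt (2 * pi))) ^ DIM('a))"
    by (simp add: power_mult_distrib)
  also have "(T * sqrt (2 * pi)) * (S * sqrt (2 * pi)) = 1"
    using T by (simp add: S_def)
  finally have e: "(LINT z|lborel. gauss_kernel T (z::'a)) = 1"
    by (simp del: of_real_power)
  have sym: "gauss_kernel T (x - y) = gauss_kernel T (- x + 1 *\<^sub>R y)" for y
    by (simp add: gauss_kernel_def norm_minus_commute)
  have [measurable]: "gauss_kernel T \<in> borel_measurable (borel :: 'a measure)"
    using i by auto
  have d: "lborel = distr lborel (borel :: 'a measure) (\<lambda>y. - x + 1 *\<^sub>R y)"
    using lborel_affine[of 1 "-x"] by (simp add: density_1)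
  show "integrable lborel (\<lambda>y. gauss_kernel T (x - y))"
    unfolding sym using i by (subst (asm) d, subst (asm) integrable_distr_eq) auto
  show "(LINT y|lborel. gauss_kernel T (x - y)) = 1"
    unfolding sym using e by (subst (asm) d, subst (asm) integral_distr) auto
qed

lemma gauss_kernel_nonneg: "T > 0 \<Longrightarrow> gauss_kernel T z \<ge> 0"
  by (simp add: gauss_kernel_def)

text \<open>For T at least 1, T^k is at most (T^2)^k, so u = a T^2 reduces the claim to the decay of
  u^k / exp u.\<close>

lemma power_times_gauss_tendsto_0:
  fixes a :: real
  assumes a: "a > 0"
  shows "((\<lambda>T. T ^ k * exp (- (a * T\<^sup>2))) \<longlongrightarrow> 0) at_top"
proof (rule Lim_null_comparison)
  have "filterlim (\<lambda>T::real. a * T\<^sup>2) at_top at_top"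
    using a by (intro filterlim_tendsto_pos_mult_at_top[OF tendsto_const] filterlim_pow_at_top filterlim_ident) auto
  then have "((\<lambda>T. (a * T\<^sup>2) ^ k / exp (a * T\<^sup>2)) \<longlongrightarrow> 0) at_top"
    by (rule filterlim_compose[OF tendsto_power_div_exp_0])
  from tendsto_mult_left[OF this, of "1 / a ^ k"]
  show "((\<lambda>T. 1 / a ^ k * ((a * T\<^sup>2) ^ k / exp (a * T\<^sup>2))) \<longlongrightarrow> 0) at_top"
    by simp
  show "\<forall>\<^sub>F T in at_top. norm (T ^ k * exp (- (a * T\<^sup>2))) \<le> 1 / a ^ k * ((a * T\<^sup>2) ^ k / exp (a * T\<^sup>2))"
    using eventually_ge_at_top[of 1]
  proof eventually_elim
    case (elim T)
    then have "T ^ k \<le> (T\<^sup>2) ^ k"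
      by (intro power_mono) (auto simp: power2_eq_square)
    then show ?case
      using a elim by (simp add: power_mult_distrib exp_minus divide_simps)
  qed
qed

text \<open>Near x continuity suffices. Away from x, f is only integrable, so |f y| is paired with
  the uniform smallness \<open>c T\<close> of the kernel there. The constant |f x| is not integrable
  and needs a small integral of the kernel instead: the tail is compared with the wider kernel of
  parameter T / sqrt 2, whose total mass is 1, times a vanishing factor \<open>c' T\<close>.\<close>

lemma gauss_kernel_approximate_identity:
  fixes f :: "'a::euclidean_space \<Rightarrow> real"
  assumes f: "integrable lborel f" and cont: "isCont f x"
  shows "((\<lambda>T. LINT y|lborel. f y * gauss_kernel T (x - y)) \<longlongrightarrow> f x) at_top"
proof (rule tendstoI)
  fix e :: real
  assume "e > 0"
  then obtain \<rho> where \<rho>: "\<rho> > 0" "\<And>y. dist y x < \<rho> \<Longrightarrow> \<bar>f y - f x\<bar> < e / 2"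
    using cont unfolding continuous_at_eps_delta dist_real_def by (meson half_gt_zero)
  \<comment> \<open>Chosen so that the exponent variable u = 2 pi T |x - y| satisfies u^2 \<ge> 4 a
    T^2 outside the ball of radius \<rho>.\<close>
  define a where "a = (2 * pi * \<rho>)\<^sup>2 / 4"
  have a: "a > 0" using \<rho> by (simp add: a_def)
  define I where "I = (LINT y|lborel. \<bar>f y\<bar>)"
  define c where "c = (\<lambda>T. sqrt (2 * pi) ^ DIM('a) * (T ^ DIM('a) * exp (- (2 * a * T\<^sup>2))))"
  define c' where "c' = (\<lambda>T::real. sqrt 2 ^ DIM('a) * (T ^ 0 * exp (- (a * T\<^sup>2))))"
  have "((\<lambda>T. e / 2 + I * c T + \<bar>f x\<bar> * c' T) \<longlongrightarrow>
      e / 2 + I * (sqrt (2 * pi) ^ DIM('a) * 0) + \<bar>f x\<bar> * (sqrt 2 ^ DIM('a) * 0)) at_top"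
    unfolding c_def c'_def using a by (intro tendsto_intros power_times_gauss_tendsto_0) auto
  then have "\<forall>\<^sub>F T in at_top. e / 2 + I * c T + \<bar>f x\<bar> * c' T < e"
    by (rule order_tendstoD(2)) (use \<open>e > 0\<close> in simp)
  then show "\<forall>\<^sub>F T in at_top. dist (LINT y|lborel. f y * gauss_kernel T (x - y)) (f x) < e"
    using eventually_gt_at_top[of 0]
  proof eventually_elim
    case (elim T)
    have T2: "T / sqrt 2 > 0" using elim by simp
    note iK = integrable_gauss_kernel[OF elim(2), of x] integrable_gauss_kernel[OF T2, of x]
    have bound: "\<bar>(f y - f x) * gauss_kernel T (x - y)\<bar> \<le>
        e / 2 * gauss_kernel T (x - y) + c T * \<bar>f y\<bar> + \<bar>f x\<bar> * c' T * gauss_kernel (T / sqrt 2) (x - y)" for y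
    proof (cases "dist y x < \<rho>")
      case True
      have "\<bar>(f y - f x) * gauss_kernel T (x - y)\<bar> \<le> e / 2 * gauss_kernel T (x - y)"
        using mult_right_mono[OF less_imp_le[OF \<rho>(2)[OF True]] gauss_kernel_nonneg[OF elim(2), of "x - y"]]
          gauss_kernel_nonneg[OF elim(2), of "x - y"] by (simp add: abs_mult)
      moreover have "c T \<ge> 0" "c' T \<ge> 0"
        using elim by (simp_all add: c_def c'_def)
      ultimately show ?thesis
        using gauss_kernel_nonneg[OF T2, of "x - y"] by (simp add: add_increasing2)
    next
      case False
      define u where "u = T * (2 * pi * norm (x - y))"
      have "T * (2 * pi * \<rho>) \<le> u"
        unfolding u_def using False elim by (intro mult_left_mono) (auto simp: dist_norm norm_minus_commute)
      then have u: "(T * (2 * pi * \<rho>))\<^sup>2 \<le> u\<^sup>2"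
        using elim \<rho>(1) by (intro power_mono) auto
      have u': "4 * (a * T\<^sup>2) \<le> u\<^sup>2"
        using u by (simp add: a_def power_mult_distrib mult_ac)
      have "exp (- u\<^sup>2 / 2) \<le> exp (- (2 * a * T\<^sup>2))"
        using u' by simp
      then have "(T * sqrt (2 * pi)) ^ DIM('a) * exp (- u\<^sup>2 / 2) \<le> (T * sqrt (2 * pi)) ^ DIM('a) * exp (- (2 * a * T\<^sup>2))"
        using elim by (intro mult_left_mono) auto
      also have "\<dots> = c T"
        by (simp add: c_def power_mult_distrib)
      finally have K1: "gauss_kernel T (x - y) \<le> c T"
        by (simp add: gauss_kernel_def u_def)
      have "exp (- u\<^sup>2 / 4) \<le> exp (- (a * T\<^sup>2))"
        using u' by simp
      then have "sqrt 2 ^ DIM('a) * exp (- u\<^sup>2 / 4) * gauss_kernel (T / sqrt 2) (x - y) \<le> c' T * gauss_kernel (T / sqrt 2) (x - y)"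
        using gauss_kernel_nonneg[OF T2, of "x - y"] by (intro mult_right_mono) (auto simp: c'_def)
      \<comment> \<open>The factor exp (- u^2 / 2) is split evenly: one half has supplied the decay
        \<open>c' T\<close>, the other is the profile of the kernel with parameter T / sqrt
        2.\<close>
      also have "sqrt 2 ^ DIM('a) * exp (- u\<^sup>2 / 4) * gauss_kernel (T / sqrt 2) (x - y) =
         ((sqrt 2 * (T / sqrt 2 * sqrt (2 * pi))) ^ DIM('a)) * (exp (- u\<^sup>2 / 4) * exp (- (u / sqrt 2)\<^sup>2 / 2))"
      proof -
        have "T / sqrt 2 * (2 * pi * norm (x - y)) = u / sqrt 2"
          by (simp add: u_def)
        then show ?thesis
          unfolding gauss_kernel_def by (subst power_mult_distrib[of "sqrt 2"]) (simp only: mult_ac)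
      qed
      also have "\<dots> = gauss_kernel T (x - y)"
      proof -
        have "sqrt 2 * (T / sqrt 2 * sqrt (2 * pi)) = T * sqrt (2 * pi)"
          by simp
        moreover have "exp (- u\<^sup>2 / 4) * exp (- (u / sqrt 2)\<^sup>2 / 2) = exp (- u\<^sup>2 / 2)"
          by (simp add: exp_add[symmetric] power_divide)
        ultimately show ?thesis
          by (simp only: gauss_kernel_def u_def)
      qed
      finally have K2: "gauss_kernel T (x - y) \<le> c' T * gauss_kernel (T / sqrt 2) (x - y)" .
      have "\<bar>(f y - f x) * gauss_kernel T (x - y)\<bar> \<le> (\<bar>f y\<bar> + \<bar>f x\<bar>) * gauss_kernel T (x - y)"
        using gauss_kernel_nonneg[OF elim(2), of "x - y"] by (auto simp: abs_mult intro: mult_right_mono)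
      also have "\<dots> \<le> c T * \<bar>f y\<bar> + \<bar>f x\<bar> * (c' T * gauss_kernel (T / sqrt 2) (x - y))"
        using mult_left_mono[OF K1, of "\<bar>f y\<bar>"] mult_left_mono[OF K2, of "\<bar>f x\<bar>"]
        by (simp add: distrib_right mult.commute[of "c T"])
      finally show ?thesis
        using \<open>e > 0\<close> mult_nonneg_nonneg[OF _ gauss_kernel_nonneg[OF elim(2), of "x - y"], of "e / 2"]
        by (simp add: mult.assoc)
    qed
    have i1: "integrable lborel (\<lambda>y. e / 2 * gauss_kernel T (x - y) + c T * \<bar>f y\<bar> + \<bar>f x\<bar> * c' T * gauss_kernel (T / sqrt 2) (x - y))"
      using iK f by auto
    have m[measurable]: "f \<in> borel_measurable borel" "(\<lambda>y. gauss_kernel T (x - y)) \<in> borel_measurable borel"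
      using f iK by auto
    have i2: "integrable lborel (\<lambda>y. (f y - f x) * gauss_kernel T (x - y))"
    proof (rule Bochner_Integration.integrable_bound[OF i1])
      show "AE y in lborel. norm ((f y - f x) * gauss_kernel T (x - y)) \<le>
          norm (e / 2 * gauss_kernel T (x - y) + c T * \<bar>f y\<bar> + \<bar>f x\<bar> * c' T * gauss_kernel (T / sqrt 2) (x - y))"
        unfolding real_norm_def by (intro AE_I2 order_trans[OF bound] abs_ge_self)
    qed measurable
    have i3: "integrable lborel (\<lambda>y. f x * gauss_kernel T (x - y))"
      using iK by auto
    have "(LINT y|lborel. f y * gauss_kernel T (x - y)) = (LINT y|lborel. (f y - f x) * gauss_kernel T (x - y) + f x * gauss_kernel T (x - y))"
      by (simp add: algebra_simps)
    also have "\<dots> = (LINT y|lborel. (f y - f x) * gauss_kernel T (x - y)) + f x"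
      using Bochner_Integration.integral_add[OF i2 i3] integral_gauss_kernel[OF elim(2), of x] by simp
    finally have "dist (LINT y|lborel. f y * gauss_kernel T (x - y)) (f x) = \<bar>LINT y|lborel. (f y - f x) * gauss_kernel T (x - y)\<bar>"
      by (simp add: dist_real_def)
    also have "\<dots> \<le> (LINT y|lborel. \<bar>(f y - f x) * gauss_kernel T (x - y)\<bar>)"
      by (rule integral_abs_bound)
    also have "\<dots> \<le> (LINT y|lborel. e / 2 * gauss_kernel T (x - y) + c T * \<bar>f y\<bar> + \<bar>f x\<bar> * c' T * gauss_kernel (T / sqrt 2) (x - y))"
      by (intro integral_mono integrable_abs i1 i2 bound)
    also have "\<dots> = e / 2 + c T * I + \<bar>f x\<bar> * c' T"
      using iK f integral_gauss_kernel[OF elim(2), of x] integral_gauss_kernel[OF T2, of x]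
      by (simp add: I_def)
    finally show ?case
      using elim(1) by (simp add: mult.commute)
  qed
qed

text \<open>The Gaussian-regularised integral has two limits as T tends to infinity: the inversion
  integral, by dominated convergence with majorant |F|, and f x, by the approximate identity. Limits
  are unique.\<close>

theorem fourier_inversion:
  fixes f :: "'a::euclidean_space \<Rightarrow> real"
  defines "F \<equiv> \<lambda>\<xi>. LINT y|lborel. cis (- (2 * pi * inner y \<xi>)) * of_real (f y)"
  assumes f: "integrable lborel f" and cont: "isCont f x" and F: "integrable lborel F"
  shows "(LINT \<xi>|lborel. cis (2 * pi * inner x \<xi>) * F \<xi>) = of_real (f x)"
proof (rule tendsto_unique[OF trivial_limit_at_top_linorder])
  let ?G = "\<lambda>T \<xi>. exp (- (norm (\<xi>::'a))\<^sup>2 / (2 * T\<^sup>2))"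
  have [measurable]: "F \<in> borel_measurable borel"
    using F by auto
  show "((\<lambda>T. LINT \<xi>|lborel. cis (2 * pi * inner x \<xi>) * F \<xi> * of_real (?G T \<xi>))
      \<longlongrightarrow> (LINT \<xi>|lborel. cis (2 * pi * inner x \<xi>) * F \<xi>)) at_top"
  proof (rule integral_dominated_convergence_at_top[where w="\<lambda>\<xi>. norm (F \<xi>)"])
    show "(\<lambda>\<xi>. cis (2 * pi * inner x \<xi>) * F \<xi>) \<in> borel_measurable lborel"
      "\<And>T. (\<lambda>\<xi>. cis (2 * pi * inner x \<xi>) * F \<xi> * of_real (?G T \<xi>)) \<in> borel_measurable lborel"
      unfolding cis_conv_exp by measurable
    show "integrable lborel (\<lambda>\<xi>. norm (F \<xi>))"
      using F by simp
    show "\<forall>\<^sub>F T in at_top. AE \<xi> in lborel. norm (cis (2 * pi * inner x \<xi>) * F \<xi> * of_real (?G T \<xi>)) \<le> norm (F \<xi>)"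
      by (intro always_eventually allI AE_I2) (auto simp: norm_mult intro!: mult_left_le)
    show "AE \<xi> in lborel. ((\<lambda>T. cis (2 * pi * inner x \<xi>) * F \<xi> * of_real (?G T \<xi>)) \<longlongrightarrow> cis (2 * pi * inner x \<xi>) * F \<xi>) at_top"
    proof (rule AE_I2)
      fix \<xi> :: 'a
      have "filterlim (\<lambda>T::real. 2 * T\<^sup>2) at_top at_top"
        by (intro filterlim_tendsto_pos_mult_at_top[OF tendsto_const] filterlim_pow_at_top filterlim_ident) auto
      then have "((\<lambda>T. - (norm \<xi>)\<^sup>2 / (2 * T\<^sup>2)) \<longlongrightarrow> 0) at_top"
        by (intro tendsto_divide_0[OF tendsto_const] filterlim_at_top_imp_at_infinity)
      then have "((\<lambda>T. ?G T \<xi>) \<longlongrightarrow> exp 0) at_top"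
        by (rule tendsto_exp)
      from tendsto_mult[OF tendsto_const tendsto_of_real[OF this]]
      show "((\<lambda>T. cis (2 * pi * inner x \<xi>) * F \<xi> * of_real (?G T \<xi>)) \<longlongrightarrow> cis (2 * pi * inner x \<xi>) * F \<xi>) at_top"
        by fastforce
    qed
  qed
  have "((\<lambda>T. complex_of_real (LINT y|lborel. f y * gauss_kernel T (x - y))) \<longlongrightarrow> of_real (f x)) at_top"
    by (intro tendsto_of_real gauss_kernel_approximate_identity f cont)
  then show "((\<lambda>T. LINT \<xi>|lborel. cis (2 * pi * inner x \<xi>) * F \<xi> * of_real (?G T \<xi>)) \<longlongrightarrow> of_real (f x)) at_top"
  proof (rule Lim_transform_eventually)
    show "\<forall>\<^sub>F T in at_top. complex_of_real (LINT y|lborel. f y * gauss_kernel T (x - y)) =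
       (LINT \<xi>|lborel. cis (2 * pi * inner x \<xi>) * F \<xi> * of_real (?G T \<xi>))"
      using eventually_gt_at_top[of 0]
      by eventually_elim (simp only: F_def gaussian_regularised_inversion[OF f])
  qed
qed

section \<open>Sampling random waves\<close>

lemma norm_cis_diff_le: "norm (cis a - cis b) \<le> \<bar>a - b\<bar>"
proof -
  have "cis a - cis b = cis b * (exp (\<i> * of_real (a - b)) - 1)"
    by (simp add: cis_conv_exp algebra_simps exp_add[symmetric])
  then have "norm (cis a - cis b) = dist (exp (\<i> * of_real (a - b))) 1"
    by (simp add: norm_mult dist_norm)
  also have "\<dots> = 2 * \<bar>sin ((a - b) / 2)\<bar>"
    using dist_exp_i_1[of "a - b"] by (simp add: dist_norm)
  also have "\<dots> \<le> \<bar>a - b\<bar>"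
    using abs_sin_x_le_abs_x[of "(a - b) / 2"] by simp
  finally show ?thesis .
qed

text \<open>Jensen's inequality for the square root, read off from the nonnegativity of the variance
  of sqrt Y.\<close>

lemma (in prob_space) expectation_sqrt_le:
  assumes Y: "integrable M Y" and nonneg: "\<And>\<omega>. 0 \<le> Y \<omega>"
  shows integrable_sqrt: "integrable M (\<lambda>\<omega>. sqrt (Y \<omega>))"
    and "expectation (\<lambda>\<omega>. sqrt (Y \<omega>)) \<le> sqrt (expectation Y)"
proof -
  have [measurable]: "Y \<in> borel_measurable M"
    using Y by auto
  have sq: "(\<lambda>\<omega>. (sqrt (Y \<omega>))\<^sup>2) = Y"
    using nonneg by auto
  show i: "integrable M (\<lambda>\<omega>. sqrt (Y \<omega>))"
    by (rule square_integrable_imp_integrable) (use Y sq in auto)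
  have "0 \<le> variance (\<lambda>\<omega>. sqrt (Y \<omega>))"
    by (rule variance_positive)
  also have "\<dots> = expectation Y - (expectation (\<lambda>\<omega>. sqrt (Y \<omega>)))\<^sup>2"
    by (subst variance_eq) (use i Y sq in auto)
  finally show "expectation (\<lambda>\<omega>. sqrt (Y \<omega>)) \<le> sqrt (expectation Y)"
    by (intro real_le_rsqrt) simp
qed

lemma (in prob_space) ex_le_expectation:
  fixes F :: "'a \<Rightarrow> real"
  assumes "integrable M F" and "expectation F \<le> c"
  shows "\<exists>\<omega>\<in>space M. F \<omega> \<le> c"
proof (rule ccontr)
  assume "\<not> ?thesis"
  then have "AE \<omega> in M. c < F \<omega>"
    by (intro AE_I2) auto
  then have "c < expectation F"
    using assms(1) by (intro expectation_greater) auto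
  with assms(2) show False by simp
qed

lemma mean_square_le: "((a + b) / 2)\<^sup>2 \<le> (a\<^sup>2 + b\<^sup>2) / 2" for a b :: real
  using sum_squares_ge_zero[of "a - b" 0] by (simp add: power2_eq_square field_simps)

text \<open>The space carries a single draw; repeated independent draws appear as nested
  expectations. In the application a point of \<open>M\<close> is a frequency, \<open>X\<close> is 2
  pi times it, \<open>U\<close> is the phase of the Fourier transform and \<open>D\<close> is the
  cube. The origin serves as the reference point from which oscillations over \<open>D\<close> are
  measured.\<close>

locale random_waves = prob_space M
  for M :: "'a measure" +
  fixes X :: "'a \<Rightarrow> 'e::euclidean_space" and U :: "'a \<Rightarrow> complex"
    and D :: "'e set" and r :: real
  assumes X_measurable[measurable]: "X \<in> borel_measurable M"
    and U_measurable[measurable]: "U \<in> borel_measurable M"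
    and norm_U: "\<And>\<omega>. cmod (U \<omega>) = 1"
    and X_square: "integrable M (\<lambda>\<omega>. (norm (X \<omega>))\<^sup>2)"
    and zero_in_D: "0 \<in> D"
    and norm_D: "\<And>x. x \<in> D \<Longrightarrow> norm x \<le> r"
begin

definition wave :: "'a \<Rightarrow> 'e \<Rightarrow> real" where
  "wave \<omega> x = Re (U \<omega> * cis (inner x (X \<omega>)))"

definition mean :: "'e \<Rightarrow> real" where
  "mean x = expectation (\<lambda>\<omega>. wave \<omega> x)"

definition bdd :: "('e \<Rightarrow> real) \<Rightarrow> bool" where
  "bdd h \<longleftrightarrow> (\<exists>C. \<forall>x\<in>D. \<bar>h x\<bar> \<le> C)"

definition sup_D :: "('e \<Rightarrow> real) \<Rightarrow> real" where
  "sup_D h = (SUP x\<in>D. h x)"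

text \<open>Integrates out one fresh sample with a fair random sign. The coefficient 2 is the price
  of writing a centred wave as a midpoint.\<close>

definition sign_avg :: "(('e \<Rightarrow> real) \<Rightarrow> real) \<Rightarrow> ('e \<Rightarrow> real) \<Rightarrow> real" where
  "sign_avg A h = (expectation (\<lambda>\<omega>. A (\<lambda>x. h x + 2 * inner x (X \<omega>))) +
                   expectation (\<lambda>\<omega>. A (\<lambda>x. h x + (- 2) * inner x (X \<omega>)))) / 2"

text \<open>Monotonicity and the sup-norm Lipschitz bound in one inequality; it also forces
  \<open>A\<close> to see only the values on \<open>D\<close>. The restriction to bounded functions
  is there because a real \<open>SUP\<close> over an unbounded set carries no information.\<close>

definition lip :: "(('e \<Rightarrow> real) \<Rightarrow> real) \<Rightarrow> bool" where
  "lip A \<longleftrightarrow> (\<forall>h h' c. bdd h \<longrightarrow> bdd h' \<longrightarrow> (\<forall>x\<in>D. h x \<le> h' x + c) \<longrightarrow> A h \<le> A h' + c)"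

text \<open>The contraction principle for a single random sign, all other randomness being hidden in
  \<open>A\<close>. Comparing increments instead of values admits waves, which do not vanish at the
  origin.\<close>

definition contracting :: "(('e \<Rightarrow> real) \<Rightarrow> real) \<Rightarrow> bool" where
  "contracting A \<longleftrightarrow> (\<forall>h p q. bdd h \<longrightarrow> bdd p \<longrightarrow> bdd q \<longrightarrow>
     (\<forall>x\<in>D. \<forall>y\<in>D. \<bar>p x - p y\<bar> \<le> \<bar>q x - q y\<bar>) \<longrightarrow>
     A (\<lambda>x. h x + p x) + A (\<lambda>x. h x - p x) \<le> A (\<lambda>x. h x + q x) + A (\<lambda>x. h x - q x))"

definition midconvex :: "(('e \<Rightarrow> real) \<Rightarrow> real) \<Rightarrow> bool" where
  "midconvex A \<longleftrightarrow> (\<forall>h h'. bdd h \<longrightarrow> bdd h' \<longrightarrow> A (\<lambda>x. (h x + h' x) / 2) \<le> (A h + A h') / 2)"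

text \<open>Jensen's inequality only for multiples of the random wave, which needs pointwise means
  but no integration in a function space.\<close>

definition jensen :: "(('e \<Rightarrow> real) \<Rightarrow> real) \<Rightarrow> bool" where
  "jensen A \<longleftrightarrow> (\<forall>h t. bdd h \<longrightarrow> A (\<lambda>x. h x + t * mean x) \<le> expectation (\<lambda>\<omega>. A (\<lambda>x. h x + t * wave \<omega> x)))"

section \<open>Bounded functions on \<open>D\<close> and bounds for waves\<close>

lemma r_nonneg: "r \<ge> 0"
  using norm_D[OF zero_in_D] by simp

lemma bddI: "(\<And>x. x \<in> D \<Longrightarrow> \<bar>h x\<bar> \<le> C) \<Longrightarrow> bdd h"
  unfolding bdd_def by blast

lemma bdd_const[simp]: "bdd (\<lambda>x. c)"
  by (auto intro: bddI)

lemma bdd_add[simp]: "bdd h \<Longrightarrow> bdd h' \<Longrightarrow> bdd (\<lambda>x. h x + h' x)"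
proof -
  assume "bdd h" "bdd h'"
  then obtain C C' where "\<And>x. x \<in> D \<Longrightarrow> \<bar>h x\<bar> \<le> C" "\<And>x. x \<in> D \<Longrightarrow> \<bar>h' x\<bar> \<le> C'"
    unfolding bdd_def by blast
  then show ?thesis
    by (intro bddI[where C="C + C'"]) (meson abs_triangle_ineq add_mono order_trans)
qed

lemma bdd_cmult[simp]: "bdd h \<Longrightarrow> bdd (\<lambda>x. c * h x)"
proof -
  assume "bdd h"
  then obtain C where "\<And>x. x \<in> D \<Longrightarrow> \<bar>h x\<bar> \<le> C"
    unfolding bdd_def by blast
  then show ?thesis
    by (intro bddI[where C="\<bar>c\<bar> * C"]) (auto simp: abs_mult intro: mult_left_mono)
qed

lemma bdd_uminus[simp]: "bdd h \<Longrightarrow> bdd (\<lambda>x. - h x)"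
  unfolding bdd_def by simp

lemma bdd_diff[simp]: "bdd h \<Longrightarrow> bdd h' \<Longrightarrow> bdd (\<lambda>x. h x - h' x)"
  using bdd_add[of h "\<lambda>x. - h' x"] by simp

lemma bdd_divide[simp]: "bdd h \<Longrightarrow> bdd (\<lambda>x. h x / c)"
  using bdd_cmult[of h "1 / c"] by simp

lemma abs_inner_le: "x \<in> D \<Longrightarrow> \<bar>inner x v\<bar> \<le> r * norm v"
  by (meson Cauchy_Schwarz_ineq2 mult_right_mono norm_D norm_ge_zero order_trans)

lemma bdd_inner[simp]: "bdd (\<lambda>x. inner x v)"
  by (rule bddI, erule abs_inner_le)

lemma abs_Re_cis_le: "\<bar>Re (z * cis a)\<bar> \<le> cmod z"
  using abs_Re_le_cmod[of "z * cis a"] by (simp add: norm_mult)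

lemma bdd_Re_cis[simp]: "bdd (\<lambda>x. Re (z * cis (inner x v)))"
  by (rule bddI, rule abs_Re_cis_le)

lemma abs_wave_le: "\<bar>wave \<omega> x\<bar> \<le> 1"
  using abs_Re_cis_le[of "U \<omega>"] by (simp add: wave_def norm_U)

lemma bdd_wave[simp]: "bdd (wave \<omega>)"
  by (rule bddI, rule abs_wave_le)

lemma wave_measurable[measurable]: "(\<lambda>\<omega>. wave \<omega> x) \<in> borel_measurable M"
  unfolding wave_def cis_conv_exp by measurable

lemma integrable_wave[simp]: "integrable M (\<lambda>\<omega>. wave \<omega> x)"
  by (rule integrable_const_bound[of _ 1]) (use abs_wave_le in auto)

lemma abs_mean_le: "\<bar>mean x\<bar> \<le> 1"
proof -
  have "\<bar>mean x\<bar> \<le> expectation (\<lambda>\<omega>. \<bar>wave \<omega> x\<bar>)"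
    unfolding mean_def by (rule integral_abs_bound)
  also have "\<dots> \<le> 1"
    using abs_wave_le by (intro integral_le_const) auto
  finally show ?thesis .
qed

lemma bdd_mean[simp]: "bdd mean"
  by (rule bddI, rule abs_mean_le)

lemma integrable_norm_X[simp]: "integrable M (\<lambda>\<omega>. norm (X \<omega>))"
  by (rule square_integrable_imp_integrable) (use X_square in auto)

lemma lipD: "lip A \<Longrightarrow> bdd h \<Longrightarrow> bdd h' \<Longrightarrow> (\<And>x. x \<in> D \<Longrightarrow> h x \<le> h' x + c) \<Longrightarrow> A h \<le> A h' + c"
  unfolding lip_def by blast

lemma lip_absD:
  assumes "lip A" "bdd h" "bdd h'" and le: "\<And>x. x \<in> D \<Longrightarrow> \<bar>h x - h' x\<bar> \<le> c"
  shows "\<bar>A h - A h'\<bar> \<le> c"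
proof -
  have "A h \<le> A h' + c"
    using le by (intro lipD[OF assms(1-3)]) fastforce
  moreover have "A h' \<le> A h + c"
    using le by (intro lipD[OF assms(1,3,2)]) fastforce
  ultimately show ?thesis by linarith
qed

text \<open>Serves twice: with different factors for continuity in the parameters, and with equal
  factors for the 1-Lipschitz dependence of a wave on its phase.\<close>

lemma Re_cis_diff_le: "\<bar>Re (z * cis a) - Re (z' * cis b)\<bar> \<le> cmod (z - z') + cmod z' * \<bar>a - b\<bar>"
proof -
  have "\<bar>Re (z * cis a) - Re (z' * cis b)\<bar> \<le> cmod (z * cis a - z' * cis b)"
    using abs_Re_le_cmod[of "z * cis a - z' * cis b"] by simp
  also have "z * cis a - z' * cis b = (z - z') * cis a + z' * (cis a - cis b)"
    by (simp add: algebra_simps)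
  also have "cmod \<dots> \<le> cmod (z - z') + cmod z' * cmod (cis a - cis b)"
    by (rule order_trans[OF norm_triangle_ineq]) (simp add: norm_mult)
  also have "\<dots> \<le> cmod (z - z') + cmod z' * \<bar>a - b\<bar>"
    by (intro add_left_mono mult_left_mono norm_cis_diff_le norm_ge_zero)
  finally show ?thesis .
qed

text \<open>The random function depends on finitely many parameters (v, v', z). By
  \<open>lip\<close>, \<open>A\<close> is continuous in them, since a change of parameters moves the
  function little uniformly on the bounded set \<open>D\<close>. Measurability thus follows without
  a countable dense subset of \<open>D\<close>. The separate slots \<open>P\<close> and
  \<open>Q\<close> allow the linear part and the wave to use different samples.\<close>

lemma lip_measurable:
  assumes A: "lip A" and h: "bdd h"
    and [measurable]: "P \<in> borel_measurable N" "Q \<in> borel_measurable N" "Z \<in> borel_measurable N"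
  shows "(\<lambda>\<omega>. A (\<lambda>x. h x + s * inner x (P \<omega>) + t * Re (Z \<omega> * cis (inner x (Q \<omega>))))) \<in> borel_measurable N"
proof -
  let ?h = "\<lambda>(v, v', z) x. h x + s * inner x v + t * Re (z * cis (inner x v'))"
  define F where "F p = A (?h p)" for p
  have "isCont F p" for p
  proof -
    obtain w w' y where p: "p = (w, w', y)" by (cases p)
    have bd: "bdd (?h q)" for q
      by (cases q) (auto simp del: times_complex.sel simp: h)
    define b where "b q = (case q of (v, v', z) \<Rightarrow> \<bar>s\<bar> * (r * norm (v - w)) + \<bar>t\<bar> * (cmod (z - y) + cmod y * (r * norm (v' - w'))))" for q
    have "\<bar>F q - F p\<bar> \<le> b q" for q
      unfolding F_def
    proof (rule lip_absD[OF A bd bd])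
      fix x assume x: "x \<in> D"
      obtain v v' z where q: "q = (v, v', z)" by (cases q)
      have "\<bar>s * inner x (v - w)\<bar> \<le> \<bar>s\<bar> * (r * norm (v - w))"
        unfolding abs_mult by (intro mult_left_mono abs_inner_le x) auto
      moreover have "\<bar>t * (Re (z * cis (inner x v')) - Re (y * cis (inner x w')))\<bar> \<le> \<bar>t\<bar> * (cmod (z - y) + cmod y * (r * norm (v' - w')))"
        unfolding abs_mult
      proof (intro mult_left_mono)
        have "\<bar>inner x v' - inner x w'\<bar> \<le> r * norm (v' - w')"
          using abs_inner_le[OF x, of "v' - w'"] by (simp add: inner_diff_right)
        then show "\<bar>Re (z * cis (inner x v')) - Re (y * cis (inner x w'))\<bar> \<le> cmod (z - y) + cmod y * (r * norm (v' - w'))"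
          by (intro order_trans[OF Re_cis_diff_le] add_left_mono mult_left_mono) auto
      qed auto
      moreover have "?h q x - ?h p x = s * inner x (v - w) + t * (Re (z * cis (inner x v')) - Re (y * cis (inner x w')))"
        by (simp add: p q inner_diff_right algebra_simps)
      ultimately show "\<bar>?h q x - ?h p x\<bar> \<le> b q"
        by (simp add: b_def q)
    qed
    moreover have "(b \<longlongrightarrow> b p) (at p)"
      unfolding b_def case_prod_unfold by (intro tendsto_intros)
    then have "(b \<longlongrightarrow> 0) (at p)"
      by (simp add: b_def p)
    ultimately show "isCont F p"
      unfolding isCont_def by (subst LIM_zero_iff[symmetric]) (rule Lim_null_comparison[of _ b], auto)
  qed
  then have "continuous_on UNIV F"
    by (simp add: continuous_on_eq_continuous_at)
  then have [measurable]: "F \<in> borel_measurable borel"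
    by (rule borel_measurable_continuous_onI)
  have "(\<lambda>\<omega>. F (P \<omega>, Q \<omega>, Z \<omega>)) \<in> borel_measurable N"
    by measurable
  then show ?thesis
    by (simp add: F_def)
qed

lemma lip_integrable:
  assumes A: "lip A" and h: "bdd h" and N: "finite_measure N"
    and [measurable]: "P \<in> borel_measurable N" "Q \<in> borel_measurable N" "Z \<in> borel_measurable N"
    and Z: "\<And>\<omega>. cmod (Z \<omega>) \<le> 1" and P: "integrable N (\<lambda>\<omega>. norm (P \<omega>))"
  shows "integrable N (\<lambda>\<omega>. A (\<lambda>x. h x + s * inner x (P \<omega>) + t * Re (Z \<omega> * cis (inner x (Q \<omega>)))))"
proof (rule Bochner_Integration.integrable_bound)
  interpret N: finite_measure N by fact
  show "integrable N (\<lambda>\<omega>. \<bar>A h\<bar> + (\<bar>s\<bar> * (r * norm (P \<omega>)) + \<bar>t\<bar>))"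
    using P by auto
  show "AE \<omega> in N. norm (A (\<lambda>x. h x + s * inner x (P \<omega>) + t * Re (Z \<omega> * cis (inner x (Q \<omega>)))))
      \<le> norm (\<bar>A h\<bar> + (\<bar>s\<bar> * (r * norm (P \<omega>)) + \<bar>t\<bar>))"
  proof (rule AE_I2)
    fix \<omega>
    have "\<bar>A (\<lambda>x. h x + s * inner x (P \<omega>) + t * Re (Z \<omega> * cis (inner x (Q \<omega>)))) - A h\<bar> \<le> \<bar>s\<bar> * (r * norm (P \<omega>)) + \<bar>t\<bar>"
    proof (rule lip_absD[OF A])
      fix x assume x: "x \<in> D"
      have "\<bar>s * inner x (P \<omega>)\<bar> \<le> \<bar>s\<bar> * (r * norm (P \<omega>))"
        unfolding abs_mult by (intro mult_left_mono abs_inner_le x) auto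
      moreover have "\<bar>t * Re (Z \<omega> * cis (inner x (Q \<omega>)))\<bar> \<le> \<bar>t\<bar>"
        unfolding abs_mult by (intro mult_left_le order_trans[OF abs_Re_cis_le Z]) auto
      ultimately show "\<bar>h x + s * inner x (P \<omega>) + t * Re (Z \<omega> * cis (inner x (Q \<omega>))) - h x\<bar> \<le> \<bar>s\<bar> * (r * norm (P \<omega>)) + \<bar>t\<bar>"
        by linarith
    qed (use h in \<open>auto simp del: times_complex.sel\<close>)
    then show "norm (A (\<lambda>x. h x + s * inner x (P \<omega>) + t * Re (Z \<omega> * cis (inner x (Q \<omega>)))))
      \<le> norm (\<bar>A h\<bar> + (\<bar>s\<bar> * (r * norm (P \<omega>)) + \<bar>t\<bar>))"
      unfolding real_norm_def by linarith
  qed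
qed (intro lip_measurable assms)

lemma integrable_lip_inner:
  assumes "lip A" "bdd h"
  shows "integrable M (\<lambda>\<omega>. A (\<lambda>x. h x + s * inner x (X \<omega>)))"
  using lip_integrable[OF assms finite_measure_axioms, of X X U s 0] norm_U by simp

lemma integrable_lip_wave:
  assumes "lip A" "bdd h"
  shows "integrable M (\<lambda>\<omega>. A (\<lambda>x. h x + t * wave \<omega> x))"
  using lip_integrable[OF assms finite_measure_axioms, of X X U 0 t] norm_U by (simp add: wave_def)

text \<open>Justifies exchanging two samples by Fubini: one inside \<open>sign_avg\<close>, the
  other from Jensen's inequality.\<close>

lemma integrable_lip_pair:
  assumes "lip A" "bdd h"
  shows "integrable (M \<Otimes>\<^sub>M M) (\<lambda>(\<omega>, \<omega>'). A (\<lambda>x. h x + s * inner x (X \<omega>) + t * wave \<omega>' x))"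
proof -
  interpret P: pair_prob_space M M ..
  have "integrable (M \<Otimes>\<^sub>M M) (\<lambda>p. A (\<lambda>x. h x + s * inner x (X (fst p)) + t * Re (U (snd p) * cis (inner x (X (snd p))))))"
  proof (rule lip_integrable[OF assms P.finite_measure_axioms])
    show "integrable (M \<Otimes>\<^sub>M M) (\<lambda>p. norm (X (fst p)))"
      by (rule P.Fubini_integrable) auto
  qed (use norm_U in auto)
  then show ?thesis
    by (simp add: wave_def case_prod_unfold)
qed

section \<open>The supremum has the four properties\<close>

lemma sup_D_upper: "bdd h \<Longrightarrow> x \<in> D \<Longrightarrow> h x \<le> sup_D h"
  unfolding sup_D_def bdd_def by (metis (no_types, lifting) abs_le_D1 bdd_aboveI2 cSUP_upper)

lemma sup_D_least: "(\<And>x. x \<in> D \<Longrightarrow> h x \<le> c) \<Longrightarrow> sup_D h \<le> c"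
  unfolding sup_D_def using zero_in_D by (intro cSUP_least) auto

lemma lip_sup_D: "lip sup_D"
  unfolding lip_def
proof (intro allI impI)
  fix h h' :: "'e \<Rightarrow> real" and c
  assume h: "bdd h" "bdd h'" and le: "\<forall>x\<in>D. h x \<le> h' x + c"
  show "sup_D h \<le> sup_D h' + c"
    using le sup_D_upper[OF h(2)] by (intro sup_D_least) fastforce
qed

text \<open>For points x and y, p x - p y is at most |q x - q y|. According to the sign of q x - q
  y, the pair (x, y) or the swapped pair (y, x) is a competitor for the two suprema on the
  right.\<close>

lemma contracting_sup_D: "contracting sup_D"
  unfolding contracting_def
proof (intro allI impI)
  fix h p q :: "'e \<Rightarrow> real"
  assume h: "bdd h" "bdd p" "bdd q" and le: "\<forall>x\<in>D. \<forall>y\<in>D. \<bar>p x - p y\<bar> \<le> \<bar>q x - q y\<bar>"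
  let ?R = "sup_D (\<lambda>x. h x + q x) + sup_D (\<lambda>x. h x - q x)"
  have pt: "(h x + p x) + (h y - p y) \<le> ?R" if "x \<in> D" "y \<in> D" for x y
  proof -
    have "h x + q x \<le> sup_D (\<lambda>x. h x + q x)" "h y + q y \<le> sup_D (\<lambda>x. h x + q x)"
      "h x - q x \<le> sup_D (\<lambda>x. h x - q x)" "h y - q y \<le> sup_D (\<lambda>x. h x - q x)"
      using that h sup_D_upper[of "\<lambda>x. h x + q x"] sup_D_upper[of "\<lambda>x. h x - q x"] by simp_all
    moreover have "p x - p y \<le> \<bar>q x - q y\<bar>"
      using le that by fastforce
    ultimately show ?thesis
      by linarith
  qed
  have "sup_D (\<lambda>y. h y - p y) \<le> ?R - (h x + p x)" if "x \<in> D" for x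
    using pt[OF that] by (intro sup_D_least) (simp add: algebra_simps)
  then have "sup_D (\<lambda>x. h x + p x) \<le> ?R - sup_D (\<lambda>y. h y - p y)"
    by (intro sup_D_least) (simp add: algebra_simps)
  then show "sup_D (\<lambda>x. h x + p x) + sup_D (\<lambda>x. h x - p x) \<le> ?R"
    by simp
qed

lemma midconvex_sup_D: "midconvex sup_D"
  unfolding midconvex_def
proof (intro allI impI sup_D_least)
  fix h h' :: "'e \<Rightarrow> real" and x
  assume "bdd h" "bdd h'" "x \<in> D"
  then show "(h x + h' x) / 2 \<le> (sup_D h + sup_D h') / 2"
    using sup_D_upper[of h x] sup_D_upper[of h' x] by simp
qed

lemma jensen_sup_D: "jensen sup_D"
  unfolding jensen_def
proof (intro allI impI sup_D_least)
  fix h :: "'e \<Rightarrow> real" and t x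
  assume h: "bdd h" and x: "x \<in> D"
  have "h x + t * mean x = expectation (\<lambda>\<omega>. h x + t * wave \<omega> x)"
    by (simp add: mean_def prob_space)
  also have "\<dots> \<le> expectation (\<lambda>\<omega>. sup_D (\<lambda>x. h x + t * wave \<omega> x))"
  proof (rule integral_mono)
    show "h x + t * wave \<omega> x \<le> sup_D (\<lambda>x. h x + t * wave \<omega> x)" for \<omega>
      using x h by (intro sup_D_upper[of "\<lambda>x. h x + t * wave \<omega> x"]) auto
  qed (simp_all add: integrable_lip_wave lip_sup_D h)
  finally show "h x + t * mean x \<le> expectation (\<lambda>\<omega>. sup_D (\<lambda>x. h x + t * wave \<omega> x))" .
qed

section \<open>Averaging over a signed sample preserves the four properties\<close>

lemma lip_sign_avg:
  assumes A: "lip A"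
  shows "lip (sign_avg A)"
  unfolding lip_def
proof (intro allI impI)
  fix h h' :: "'e \<Rightarrow> real" and c
  assume h: "bdd h" "bdd h'" and le: "\<forall>x\<in>D. h x \<le> h' x + c"
  have "expectation (\<lambda>\<omega>. A (\<lambda>x. h x + s * inner x (X \<omega>))) \<le> expectation (\<lambda>\<omega>. A (\<lambda>x. h' x + s * inner x (X \<omega>)) + c)" for s
  proof (rule integral_mono)
    show "A (\<lambda>x. h x + s * inner x (X \<omega>)) \<le> A (\<lambda>x. h' x + s * inner x (X \<omega>)) + c" for \<omega>
      using le h by (intro lipD[OF A]) auto
  qed (simp_all add: integrable_lip_inner A h)
  then have *: "expectation (\<lambda>\<omega>. A (\<lambda>x. h x + s * inner x (X \<omega>))) \<le> expectation (\<lambda>\<omega>. A (\<lambda>x. h' x + s * inner x (X \<omega>))) + c" for s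
    by (simp add: integrable_lip_inner[OF A h(2)] prob_space)
  show "sign_avg A h \<le> sign_avg A h' + c"
    unfolding sign_avg_def using *[of 2] *[of "- 2"] by argo
qed

text \<open>For a fixed sample the linear term is absorbed into \<open>h\<close>, where the property
  of \<open>A\<close> permits any bounded function; integration keeps the inequality. Midpoint
  convexity is inherited in the same way.\<close>

lemma contracting_sign_avg:
  assumes A: "lip A" "contracting A"
  shows "contracting (sign_avg A)"
  unfolding contracting_def
proof (intro allI impI)
  fix h p q :: "'e \<Rightarrow> real"
  assume h: "bdd h" "bdd p" "bdd q" and le: "\<forall>x\<in>D. \<forall>y\<in>D. \<bar>p x - p y\<bar> \<le> \<bar>q x - q y\<bar>"
  let ?E = "\<lambda>s h. expectation (\<lambda>\<omega>. A (\<lambda>x. h x + s * inner x (X \<omega>)))"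
  note I = integrable_lip_inner[OF A(1)]
  have "?E s (\<lambda>x. h x + p x) + ?E s (\<lambda>x. h x - p x) \<le> ?E s (\<lambda>x. h x + q x) + ?E s (\<lambda>x. h x - q x)" for s
  proof -
    have "A (\<lambda>x. h x + p x + s * inner x (X \<omega>)) + A (\<lambda>x. h x - p x + s * inner x (X \<omega>))
      \<le> A (\<lambda>x. h x + q x + s * inner x (X \<omega>)) + A (\<lambda>x. h x - q x + s * inner x (X \<omega>))" for \<omega>
    proof -
      have "A (\<lambda>x. (h x + s * inner x (X \<omega>)) + p x) + A (\<lambda>x. (h x + s * inner x (X \<omega>)) - p x)
        \<le> A (\<lambda>x. (h x + s * inner x (X \<omega>)) + q x) + A (\<lambda>x. (h x + s * inner x (X \<omega>)) - q x)"
        using A(2)[unfolded contracting_def, rule_format, of "\<lambda>x. h x + s * inner x (X \<omega>)" p q] h le by simp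
      then show ?thesis
        by (simp add: algebra_simps)
    qed
    then have "expectation (\<lambda>\<omega>. A (\<lambda>x. h x + p x + s * inner x (X \<omega>)) + A (\<lambda>x. h x - p x + s * inner x (X \<omega>)))
      \<le> expectation (\<lambda>\<omega>. A (\<lambda>x. h x + q x + s * inner x (X \<omega>)) + A (\<lambda>x. h x - q x + s * inner x (X \<omega>)))"
      using h by (intro integral_mono Bochner_Integration.integrable_add I bdd_add bdd_diff)
    then show ?thesis
      using h by (simp add: I)
  qed
  from this[of 2] this[of "- 2"]
  show "sign_avg A (\<lambda>x. h x + p x) + sign_avg A (\<lambda>x. h x - p x) \<le> sign_avg A (\<lambda>x. h x + q x) + sign_avg A (\<lambda>x. h x - q x)"
    unfolding sign_avg_def by argo
qed

lemma midconvex_sign_avg: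
  assumes A: "lip A" "midconvex A"
  shows "midconvex (sign_avg A)"
  unfolding midconvex_def
proof (intro allI impI)
  fix h h' :: "'e \<Rightarrow> real"
  assume h: "bdd h" "bdd h'"
  let ?E = "\<lambda>s h. expectation (\<lambda>\<omega>. A (\<lambda>x. h x + s * inner x (X \<omega>)))"
  note I = integrable_lip_inner[OF A(1)]
  have "?E s (\<lambda>x. (h x + h' x) / 2) \<le> (?E s h + ?E s h') / 2" for s
  proof -
    have "A (\<lambda>x. (h x + h' x) / 2 + s * inner x (X \<omega>)) \<le> (A (\<lambda>x. h x + s * inner x (X \<omega>)) + A (\<lambda>x. h' x + s * inner x (X \<omega>))) / 2" for \<omega>
    proof -
      have "(\<lambda>x. (h x + h' x) / 2 + s * inner x (X \<omega>)) = (\<lambda>x. ((h x + s * inner x (X \<omega>)) + (h' x + s * inner x (X \<omega>))) / 2)"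
        by (auto simp: field_simps)
      then show ?thesis
        using A(2)[unfolded midconvex_def, rule_format, of "\<lambda>x. h x + s * inner x (X \<omega>)" "\<lambda>x. h' x + s * inner x (X \<omega>)"] h by simp
    qed
    then have "?E s (\<lambda>x. (h x + h' x) / 2) \<le> expectation (\<lambda>\<omega>. (A (\<lambda>x. h x + s * inner x (X \<omega>)) + A (\<lambda>x. h' x + s * inner x (X \<omega>))) / 2)"
      using h by (intro integral_mono Bochner_Integration.integrable_add integrable_divide I bdd_add bdd_divide)
    then show ?thesis
      using h by (simp add: I)
  qed
  from this[of 2] this[of "- 2"]
  show "sign_avg A (\<lambda>x. (h x + h' x) / 2) \<le> (sign_avg A h + sign_avg A h') / 2"
    unfolding sign_avg_def by argo
qed

text \<open>Jensen for \<open>A\<close> is applied inside the expectation over the signed sample;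
  Fubini then moves the new wave sample to the outside.\<close>

lemma jensen_sign_avg:
  assumes A: "lip A" "jensen A"
  shows "jensen (sign_avg A)"
  unfolding jensen_def
proof (intro allI impI)
  fix h :: "'e \<Rightarrow> real" and t
  assume h: "bdd h"
  interpret P: pair_prob_space M M ..
  let ?F = "\<lambda>s \<omega> \<omega>'. A (\<lambda>x. h x + s * inner x (X \<omega>) + t * wave \<omega>' x)"
  have comm: "(\<lambda>x. h x + t * g x + s * inner x v) = (\<lambda>x. h x + s * inner x v + t * g x)" for g :: "'e \<Rightarrow> real" and s v
    by (simp add: add_ac)
  have pair: "integrable (M \<Otimes>\<^sub>M M) (\<lambda>(\<omega>, \<omega>'). ?F s \<omega> \<omega>')" for s
    by (rule integrable_lip_pair[OF A(1) h])
  have swap: "expectation (\<lambda>\<omega>. expectation (?F s \<omega>)) = expectation (\<lambda>\<omega>'. expectation (\<lambda>\<omega>. ?F s \<omega> \<omega>'))" for s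
    using P.Fubini_integral[OF pair[of s]] by simp
  have i': "integrable M (\<lambda>\<omega>'. expectation (\<lambda>\<omega>. ?F s \<omega> \<omega>'))" for s
    using P.integrable_snd[OF pair[of s]] by simp
  have i: "integrable M (\<lambda>\<omega>. expectation (?F s \<omega>))" for s
    using P.integrable_fst[OF pair[of s]] by simp
  have "expectation (\<lambda>\<omega>. A (\<lambda>x. h x + t * mean x + s * inner x (X \<omega>))) \<le> expectation (\<lambda>\<omega>'. expectation (\<lambda>\<omega>. ?F s \<omega> \<omega>'))" for s
  proof -
    have "expectation (\<lambda>\<omega>. A (\<lambda>x. h x + t * mean x + s * inner x (X \<omega>))) \<le> expectation (\<lambda>\<omega>. expectation (?F s \<omega>))"
    proof (intro integral_mono i integrable_lip_inner A(1))
      show "A (\<lambda>x. h x + t * mean x + s * inner x (X \<omega>)) \<le> expectation (?F s \<omega>)" for \<omega>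
        unfolding comm using A(2)[unfolded jensen_def, rule_format, of "\<lambda>x. h x + s * inner x (X \<omega>)" t] h by simp
    qed (use h in auto)
    then show ?thesis
      unfolding swap .
  qed
  from this[of 2] this[of "- 2"]
  have "sign_avg A (\<lambda>x. h x + t * mean x) \<le> (expectation (\<lambda>\<omega>'. expectation (\<lambda>\<omega>. ?F 2 \<omega> \<omega>')) + expectation (\<lambda>\<omega>'. expectation (\<lambda>\<omega>. ?F (- 2) \<omega> \<omega>'))) / 2"
    unfolding sign_avg_def by argo
  also have "\<dots> = expectation (\<lambda>\<omega>. sign_avg A (\<lambda>x. h x + t * wave \<omega> x))"
    unfolding sign_avg_def comm using i'[of 2] i'[of "- 2"] by simp
  finally show "sign_avg A (\<lambda>x. h x + t * mean x) \<le> expectation (\<lambda>\<omega>. sign_avg A (\<lambda>x. h x + t * wave \<omega> x))" .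
qed

lemma wave_diff_le: "\<bar>wave \<omega> x - wave \<omega> y\<bar> \<le> \<bar>inner x (X \<omega>) - inner y (X \<omega>)\<bar>"
  using Re_cis_diff_le[of "U \<omega>" "inner x (X \<omega>)" "U \<omega>" "inner y (X \<omega>)"] norm_U
  by (simp add: wave_def)

text \<open>One step of symmetrisation and contraction at once: writing
  \<open>h + s (wave - mean)\<close> as the midpoint of \<open>h + 2 s wave\<close> and \<open>h - 2 s mean\<close> makes
  an independent copy of the sample unnecessary, as Jensen's inequality replaces \<open>mean\<close> by \<open>wave\<close>.\<close>

lemma expectation_centred_wave_le:
  assumes A: "lip A" "contracting A" "midconvex A" "jensen A" and h: "bdd h" and s: "\<bar>s\<bar> = 1"
  shows "integrable M (\<lambda>\<omega>. A (\<lambda>x. h x + s * (wave \<omega> x - mean x)))" (is "integrable M ?L")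
    and "expectation (\<lambda>\<omega>. A (\<lambda>x. h x + s * (wave \<omega> x - mean x))) \<le> sign_avg A h"
proof -
  have eq: "(\<lambda>x. h x + s * (wave \<omega> x - mean x)) = (\<lambda>x. (h x - s * mean x) + s * wave \<omega> x)" for \<omega>
    by (auto simp: algebra_simps)
  show int: "integrable M ?L"
    unfolding eq by (intro integrable_lip_wave A) (simp add: h)
  let ?W = "\<lambda>t \<omega>. A (\<lambda>x. h x + t * wave \<omega> x)"
  let ?I = "\<lambda>t \<omega>. A (\<lambda>x. h x + t * inner x (X \<omega>))"
  note iW = integrable_lip_wave[OF A(1) h] and iI = integrable_lip_inner[OF A(1) h]
  have half: "?L \<omega> \<le> (?W (2 * s) \<omega> + A (\<lambda>x. h x + (- 2 * s) * mean x)) / 2" for \<omega>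
  proof -
    have "(\<lambda>x. h x + s * (wave \<omega> x - mean x)) = (\<lambda>x. ((h x + 2 * s * wave \<omega> x) + (h x + (- 2 * s) * mean x)) / 2)"
      by (auto simp: field_simps)
    then show ?thesis
      using A(3)[unfolded midconvex_def, rule_format, of "\<lambda>x. h x + 2 * s * wave \<omega> x" "\<lambda>x. h x + (- 2 * s) * mean x"] h by simp
  qed
  have "expectation ?L \<le> expectation (\<lambda>\<omega>. (?W (2 * s) \<omega> + A (\<lambda>x. h x + (- 2 * s) * mean x)) / 2)"
    by (intro integral_mono int half integrable_divide Bochner_Integration.integrable_add iW integrable_const)
  also have "\<dots> = (expectation (?W (2 * s)) + A (\<lambda>x. h x + (- 2 * s) * mean x)) / 2"
    by (simp add: iW prob_space del: mult_minus_left)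
  \<comment> \<open>The mean carries the sign opposite to the sampled wave. After Jensen the two
    waves can be evaluated at the same \<omega>, since only the sum of their expectations matters,
    and they form the pair h + 2 s wave, h - 2 s wave required by the contraction property.\<close>
  also have "A (\<lambda>x. h x + (- 2 * s) * mean x) \<le> expectation (?W (- 2 * s))"
    using A(4) h unfolding jensen_def by blast
  also have "(expectation (?W (2 * s)) + expectation (?W (- 2 * s))) / 2 = expectation (\<lambda>\<omega>. (?W (2 * s) \<omega> + ?W (- 2 * s) \<omega>) / 2)"
    using iW[of "2 * s"] iW[of "- 2 * s"] by (simp del: mult_minus_left)
  also have "\<dots> \<le> expectation (\<lambda>\<omega>. (?I 2 \<omega> + ?I (- 2) \<omega>) / 2)"
  proof (intro integral_mono integrable_divide Bochner_Integration.integrable_add iW iI divide_right_mono)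
    fix \<omega>
    have le: "\<bar>2 * s * wave \<omega> x - 2 * s * wave \<omega> y\<bar> \<le> \<bar>2 * inner x (X \<omega>) - 2 * inner y (X \<omega>)\<bar>" for x y
    proof -
      have "\<bar>2 * s * wave \<omega> x - 2 * s * wave \<omega> y\<bar> = 2 * \<bar>wave \<omega> x - wave \<omega> y\<bar>"
        using s by (simp add: right_diff_distrib[symmetric] abs_mult)
      also have "\<dots> \<le> 2 * \<bar>inner x (X \<omega>) - inner y (X \<omega>)\<bar>"
        using wave_diff_le by simp
      also have "\<dots> = \<bar>2 * inner x (X \<omega>) - 2 * inner y (X \<omega>)\<bar>"
        unfolding right_diff_distrib[symmetric] abs_mult by simp
      finally show ?thesis .
    qed
    have "A (\<lambda>x. h x + 2 * s * wave \<omega> x) + A (\<lambda>x. h x - 2 * s * wave \<omega> x)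
      \<le> A (\<lambda>x. h x + 2 * inner x (X \<omega>)) + A (\<lambda>x. h x - 2 * inner x (X \<omega>))"
      using A(2)[unfolded contracting_def, rule_format, of h "\<lambda>x. 2 * s * wave \<omega> x" "\<lambda>x. 2 * inner x (X \<omega>)"] h le by simp
    then show "?W (2 * s) \<omega> + ?W (- 2 * s) \<omega> \<le> ?I 2 \<omega> + ?I (- 2) \<omega>"
      by simp
  qed auto
  also have "\<dots> = sign_avg A h"
    unfolding sign_avg_def using iI[of 2] iI[of "- 2"] by (simp del: mult_minus_left)
  finally show "expectation ?L \<le> sign_avg A h"
    by simp
qed

text \<open>\<open>potential k h\<close> is the expectation of \<open>sup (h + 2 \<Sum>i<k. \<epsilon>\<^sub>i \<langle>\<cdot>, X\<^sub>i\<rangle>)\<close> over \<open>D\<close>, with independent samples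
  \<open>X\<^sub>i\<close> and random signs \<open>\<epsilon>\<^sub>i\<close>; iterating \<^const>\<open>sign_avg\<close> avoids product measures.\<close>

definition potential :: "nat \<Rightarrow> ('e \<Rightarrow> real) \<Rightarrow> real" where
  "potential k = (sign_avg ^^ k) sup_D"

lemma potential_Suc: "potential (Suc k) = sign_avg (potential k)"
  by (simp add: potential_def)

lemma potential_regular:
  "lip (potential k)" "contracting (potential k)" "midconvex (potential k)" "jensen (potential k)"
proof (induction k)
  case 0
  show "lip (potential 0)" "contracting (potential 0)" "midconvex (potential 0)" "jensen (potential 0)"
    by (simp_all add: potential_def lip_sup_D contracting_sup_D midconvex_sup_D jensen_sup_D)
next
  case (Suc k)
  show "lip (potential (Suc k))" "contracting (potential (Suc k))" "midconvex (potential (Suc k))" "jensen (potential (Suc k))"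
    unfolding potential_Suc using Suc
    by (simp_all add: lip_sign_avg contracting_sign_avg midconvex_sign_avg jensen_sign_avg)
qed

section \<open>Bounding the potential by second moments\<close>

definition second_moment :: real where
  "second_moment = expectation (\<lambda>\<omega>. (norm (X \<omega>))\<^sup>2)"

lemma second_moment_nonneg: "second_moment \<ge> 0"
  unfolding second_moment_def by simp

text \<open>The accumulated signed samples enter through the vector w, hence the induction over all
  w. In |w + 2 X|^2 and |w - 2 X|^2 the cross terms cancel on averaging, leaving |w|^2 + 4 |X|^2;
  concavity of the square root is used first over the sign, then over the sample.\<close>

lemma potential_inner_le:
  "potential k (\<lambda>x. inner x w) \<le> r * sqrt ((norm w)\<^sup>2 + 4 * real k * second_moment)"
proof (induction k arbitrary: w)
  case 0
  show ?case
    using abs_inner_le[of _ w] by (auto simp: potential_def abs_le_iff intro: sup_D_least)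
next
  case (Suc k)
  let ?c = "4 * real k * second_moment"
  let ?S = "\<lambda>s \<omega>. sqrt ((norm (w + s *\<^sub>R X \<omega>))\<^sup>2 + ?c)"
  let ?Y = "\<lambda>\<omega>. (norm w)\<^sup>2 + 4 * (norm (X \<omega>))\<^sup>2 + ?c"
  have c: "?c \<ge> 0"
    using second_moment_nonneg by simp
  have iY: "integrable M ?Y"
    using X_square by simp
  have nonneg: "?Y \<omega> \<ge> 0" for \<omega>
    using c by (intro add_nonneg_nonneg) auto
  note iP = integrable_lip_inner[OF potential_regular(1), of "\<lambda>x. inner x w" k]
  have "sign_avg (potential k) (\<lambda>x. inner x w)
    = expectation (\<lambda>\<omega>. (potential k (\<lambda>x. inner x w + 2 * inner x (X \<omega>)) + potential k (\<lambda>x. inner x w + (- 2) * inner x (X \<omega>))) / 2)"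
    unfolding sign_avg_def using iP[of 2] iP[of "- 2"] by (simp del: mult_minus_left)
  also have "\<dots> \<le> expectation (\<lambda>\<omega>. r * sqrt (?Y \<omega>))"
  proof (rule integral_mono)
    fix \<omega>
    have "potential k (\<lambda>x. inner x w + s * inner x (X \<omega>)) \<le> r * ?S s \<omega>" for s
      using Suc[of "w + s *\<^sub>R X \<omega>"] by (simp add: inner_add_right)
    from this[of 2] this[of "- 2"]
    have "(potential k (\<lambda>x. inner x w + 2 * inner x (X \<omega>)) + potential k (\<lambda>x. inner x w + (- 2) * inner x (X \<omega>))) / 2
       \<le> r * ((?S 2 \<omega> + ?S (- 2) \<omega>) / 2)"
      by (simp add: algebra_simps)
    also have "(?S 2 \<omega> + ?S (- 2) \<omega>) / 2 \<le> sqrt (?Y \<omega>)"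
    proof (rule real_le_rsqrt)
      have S: "(?S s \<omega>)\<^sup>2 = (norm (w + s *\<^sub>R X \<omega>))\<^sup>2 + ?c" for s
        using c by simp
      have "((?S 2 \<omega> + ?S (- 2) \<omega>) / 2)\<^sup>2 \<le> ((?S 2 \<omega>)\<^sup>2 + (?S (- 2) \<omega>)\<^sup>2) / 2"
        by (rule mean_square_le)
      also have "\<dots> = ?Y \<omega>"
        unfolding S by (simp add: power2_norm_eq_inner inner_add inner_diff inner_commute algebra_simps)
      finally show "((?S 2 \<omega> + ?S (- 2) \<omega>) / 2)\<^sup>2 \<le> ?Y \<omega>" .
    qed
    finally show "(potential k (\<lambda>x. inner x w + 2 * inner x (X \<omega>)) + potential k (\<lambda>x. inner x w + (- 2) * inner x (X \<omega>))) / 2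
       \<le> r * sqrt (?Y \<omega>)"
      using r_nonneg by (simp add: mult_left_mono)
  next
    show "integrable M (\<lambda>\<omega>. (potential k (\<lambda>x. inner x w + 2 * inner x (X \<omega>)) + potential k (\<lambda>x. inner x w + (- 2) * inner x (X \<omega>))) / 2)"
      using iP[of 2] iP[of "- 2"] by (simp del: mult_minus_left)
    show "integrable M (\<lambda>\<omega>. r * sqrt (?Y \<omega>))"
      using integrable_sqrt[OF iY nonneg] by simp
  qed
  also have "\<dots> = r * expectation (\<lambda>\<omega>. sqrt (?Y \<omega>))"
    by simp
  also have "\<dots> \<le> r * sqrt (expectation ?Y)"
    by (intro mult_left_mono r_nonneg expectation_sqrt_le iY nonneg)
  also have "expectation ?Y = (norm w)\<^sup>2 + 4 * real (Suc k) * second_moment"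
    using X_square by (simp add: prob_space second_moment_def algebra_simps)
  finally show ?case
    by (simp add: potential_Suc)
qed

text \<open>A centred wave adds at most its variance, which is at most 1, to a^2. So sqrt (a^2 + k)
  with k draws left does not grow in expectation when a draw is made; this is the part of the greedy
  potential that watches the origin.\<close>

lemma expectation_sqrt_centred_wave_le:
  assumes k: "k \<ge> 0"
  shows "integrable M (\<lambda>\<omega>. sqrt ((a + (wave \<omega> x - mean x))\<^sup>2 + k))"
    and "expectation (\<lambda>\<omega>. sqrt ((a + (wave \<omega> x - mean x))\<^sup>2 + k)) \<le> sqrt (a\<^sup>2 + (1 + k))"
proof -
  let ?Y = "\<lambda>\<omega>. (a + (wave \<omega> x - mean x))\<^sup>2 + k"
  have sq: "(wave \<omega> x)\<^sup>2 \<le> 1" for \<omega>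
    using abs_wave_le by (simp add: abs_square_le_1)
  have i2: "integrable M (\<lambda>\<omega>. (wave \<omega> x)\<^sup>2)"
    by (rule integrable_const_bound[of _ 1]) (use sq in auto)
  have Y: "?Y = (\<lambda>\<omega>. (wave \<omega> x)\<^sup>2 + 2 * (a - mean x) * wave \<omega> x + ((a - mean x)\<^sup>2 + k))"
    by (auto simp: power2_eq_square algebra_simps)
  have iY: "integrable M ?Y"
    unfolding Y using i2 by simp
  have nonneg: "0 \<le> ?Y \<omega>" for \<omega>
    using k by simp
  show "integrable M (\<lambda>\<omega>. sqrt (?Y \<omega>))"
    by (rule integrable_sqrt[OF iY nonneg])
  have "expectation (\<lambda>\<omega>. (wave \<omega> x)\<^sup>2) \<le> 1"
    using sq i2 by (intro integral_le_const) auto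
  moreover have "expectation ?Y = expectation (\<lambda>\<omega>. (wave \<omega> x)\<^sup>2) + 2 * (a - mean x) * mean x + ((a - mean x)\<^sup>2 + k)"
    unfolding Y using i2 by (simp add: prob_space mean_def)
  moreover have "2 * (a - mean x) * mean x + (a - mean x)\<^sup>2 = a\<^sup>2 - (mean x)\<^sup>2"
    by (simp add: power2_eq_square left_diff_distrib right_diff_distrib)
  ultimately have "expectation ?Y \<le> a\<^sup>2 + (1 + k)"
    using zero_le_power2[of "mean x"] by linarith
  then show "expectation (\<lambda>\<omega>. sqrt (?Y \<omega>)) \<le> sqrt (a\<^sup>2 + (1 + k))"
    using expectation_sqrt_le[OF iY nonneg] real_sqrt_le_mono order_trans by blast
qed

text \<open>Each sample is chosen so that the potential does not exceed its expectation (the method of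
  conditional expectations). As \<open>sup h + sup (- h)\<close> is the oscillation of \<open>h\<close>, the right-hand side
  for \<open>k = 0\<close> bounds \<open>\<bar>h\<bar>\<close>.\<close>

lemma greedy_sampling:
  assumes "bdd h"
  shows "\<exists>\<omega>s. length \<omega>s = k \<and> (\<forall>x\<in>D. \<bar>h x + (\<Sum>\<omega>\<leftarrow>\<omega>s. wave \<omega> x - mean x)\<bar>
     \<le> potential k h + potential k (\<lambda>x. - h x) + sqrt ((h 0)\<^sup>2 + real k))"
  using assms
proof (induction k arbitrary: h)
  case 0
  \<comment> \<open>Here |h x| is at most |h x - h 0| + |h 0|, and the difference is bounded by the
    oscillation.\<close>
  have "\<bar>h x\<bar> \<le> sup_D h + sup_D (\<lambda>x. - h x) + \<bar>h 0\<bar>" if "x \<in> D" for x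
    using sup_D_upper[OF 0 that] sup_D_upper[OF 0 zero_in_D] sup_D_upper[OF bdd_uminus[OF 0] that]
      sup_D_upper[OF bdd_uminus[OF 0] zero_in_D] by linarith
  then show ?case
    by (simp add: potential_def)
next
  case (Suc k)
  note reg = potential_regular[of k]
  let ?h = "\<lambda>\<omega> x. h x + 1 * (wave \<omega> x - mean x)"
  let ?h' = "\<lambda>\<omega> x. - h x + (- 1) * (wave \<omega> x - mean x)"
  let ?s = "\<lambda>\<omega>. sqrt ((h 0 + (wave \<omega> 0 - mean 0))\<^sup>2 + real k)"
  let ?B = "potential (Suc k) h + potential (Suc k) (\<lambda>x. - h x) + sqrt ((h 0)\<^sup>2 + real (Suc k))"
  note e1 = expectation_centred_wave_le[OF reg Suc.prems, of 1]
  note e2 = expectation_centred_wave_le[OF reg bdd_uminus[OF Suc.prems], of "- 1"]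
  note e3 = expectation_sqrt_centred_wave_le[of "real k" "h 0" 0]
  have i: "integrable M (\<lambda>\<omega>. potential k (?h \<omega>) + potential k (?h' \<omega>) + ?s \<omega>)"
    using e1(1) e2(1) e3(1) by (intro Bochner_Integration.integrable_add) simp_all
  have "expectation (\<lambda>\<omega>. potential k (?h \<omega>) + potential k (?h' \<omega>) + ?s \<omega>)
      = expectation (\<lambda>\<omega>. potential k (?h \<omega>)) + expectation (\<lambda>\<omega>. potential k (?h' \<omega>)) + expectation ?s"
    using e1(1) e2(1) e3(1) by (subst Bochner_Integration.integral_add; simp)+
  also have "\<dots> \<le> ?B"
    unfolding potential_Suc using e1(2) e2(2) e3(2) by (intro add_mono) simp_all
  \<comment> \<open>A single \<omega> must serve all three terms, so it is their sum that is
    compared with its expectation.\<close>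
  finally obtain \<omega> where \<omega>: "potential k (?h \<omega>) + potential k (?h' \<omega>) + ?s \<omega> \<le> ?B"
    using ex_le_expectation[OF i] by blast
  have "bdd (?h \<omega>)"
    using Suc.prems by simp
  from Suc.IH[OF this] obtain \<omega>s where \<omega>s: "length \<omega>s = k"
    "\<And>x. x \<in> D \<Longrightarrow> \<bar>?h \<omega> x + (\<Sum>\<omega>\<leftarrow>\<omega>s. wave \<omega> x - mean x)\<bar> \<le> potential k (?h \<omega>) + potential k (\<lambda>x. - ?h \<omega> x) + ?s \<omega>"
    by auto
  have neg: "(\<lambda>x. - ?h \<omega> x) = ?h' \<omega>"
    by auto
  have "\<bar>h x + (\<Sum>\<omega>\<leftarrow>\<omega> # \<omega>s. wave \<omega> x - mean x)\<bar> \<le> ?B" if "x \<in> D" for x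
    using \<omega>s(2)[OF that, unfolded neg] \<omega> by (simp add: add.assoc)
  then show ?case
    using \<omega>s(1) by (intro exI[of _ "\<omega> # \<omega>s"]) simp
qed

text \<open>Greedy sampling from h = 0, where both potentials agree. Each is at most 2 r sqrt n
  times the root of the second moment, which gives the factor 4; the value at the origin contributes
  sqrt n.\<close>

theorem exists_sample:
  "\<exists>\<omega>s. length \<omega>s = n \<and> (\<forall>x\<in>D. \<bar>(\<Sum>\<omega>\<leftarrow>\<omega>s. wave \<omega> x) - real n * mean x\<bar>
     \<le> sqrt (real n) * (1 + 4 * r * sqrt second_moment))"
proof -
  obtain \<omega>s where \<omega>s: "length \<omega>s = n" and le: "\<And>x. x \<in> D \<Longrightarrow> \<bar>\<Sum>\<omega>\<leftarrow>\<omega>s. wave \<omega> x - mean x\<bar> \<le> 2 * potential n (\<lambda>x. 0) + sqrt (real n)"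
    using greedy_sampling[of "\<lambda>x. 0" n] by auto
  have sum: "(\<Sum>\<omega>\<leftarrow>\<omega>s. wave \<omega> x - mean x) = (\<Sum>\<omega>\<leftarrow>\<omega>s. wave \<omega> x) - real n * mean x" for x
    unfolding \<omega>s[symmetric] by (induction \<omega>s) (auto simp: algebra_simps)
  have "potential n (\<lambda>x. 0) \<le> 2 * (r * (sqrt (real n) * sqrt second_moment))"
    using potential_inner_le[of n 0] by (simp add: real_sqrt_mult)
  then have "2 * potential n (\<lambda>x. 0) + sqrt (real n) \<le> sqrt (real n) * (1 + 4 * r * sqrt second_moment)"
    by (simp add: algebra_simps)
  then show ?thesis
    using \<omega>s le order_trans unfolding sum by blast
qed

end

section \<open>The output of the circuit\<close>

lemma mat2_eqI:
  assumes "A \<in> carrier_mat 2 2" "B \<in> carrier_mat 2 2"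
    and "A $$ (0, 0) = B $$ (0, 0)" "A $$ (0, Suc 0) = B $$ (0, Suc 0)"
    and "A $$ (Suc 0, 0) = B $$ (Suc 0, 0)" "A $$ (Suc 0, Suc 0) = B $$ (Suc 0, Suc 0)"
  shows "A = B"
proof (rule eq_matI)
  fix i j
  assume "i < dim_row B" "j < dim_col B"
  then have "i = 0 \<or> i = 1" "j = 0 \<or> j = 1"
    using assms(2) by (auto simp: less_2_cases_iff)
  then show "A $$ (i, j) = B $$ (i, j)"
    using assms by auto
qed (use assms in auto)

lemma mult_mat2_index:
  fixes A B :: "complex mat"
  assumes "A \<in> carrier_mat 2 2" "B \<in> carrier_mat 2 2" "i < 2" "j < 2"
  shows "(A * B) $$ (i, j) = A $$ (i, 0) * B $$ (0, j) + A $$ (i, Suc 0) * B $$ (Suc 0, j)"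
proof -
  have "{0..<2::nat} = {0, 1}" by auto
  then show ?thesis
    using assms by (simp add: scalar_prod_def)
qed

lemma gate_carrier[simp]:
  "hadamard \<in> carrier_mat 2 2" "rot_y \<gamma> \<in> carrier_mat 2 2" "rot_z \<alpha> \<in> carrier_mat 2 2"
  by (auto simp: hadamard_def rot_y_def rot_z_def mat_of_rows_list_def)

lemma hadamard_index:
  "hadamard $$ (0, 0) = of_real (1 / sqrt 2)" "hadamard $$ (0, Suc 0) = of_real (1 / sqrt 2)"
  "hadamard $$ (Suc 0, 0) = of_real (1 / sqrt 2)" "hadamard $$ (Suc 0, Suc 0) = - of_real (1 / sqrt 2)"
  by (simp_all add: hadamard_def mat_of_rows_list_def)

lemma rot_y_index:
  "rot_y \<gamma> $$ (0, 0) = of_real (cos (\<gamma> / 2))" "rot_y \<gamma> $$ (Suc 0, 0) = of_real (sin (\<gamma> / 2))"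
  by (simp_all add: rot_y_def mat_of_rows_list_def)

lemma rot_z_index:
  "rot_z \<alpha> $$ (0, 0) = cis (- (\<alpha> / 2))" "rot_z \<alpha> $$ (0, Suc 0) = 0"
  "rot_z \<alpha> $$ (Suc 0, 0) = 0" "rot_z \<alpha> $$ (Suc 0, Suc 0) = cis (\<alpha> / 2)"
  by (simp_all add: rot_z_def mat_of_rows_list_def cis_conv_exp)

lemma rot_z_mult: "rot_z a * rot_z b = rot_z (a + b)"
  by (rule mat2_eqI) (simp_all add: mult_mat2_index rot_z_index cis_mult add_divide_distrib
      mult_carrier_mat[of _ 2 2])

lemma rot_z_0: "rot_z 0 = 1\<^sub>m 2"
  by (rule mat2_eqI) (simp_all add: rot_z_index)

lemma foldr_rot_z: "foldr (*) (map (\<lambda>j. rot_z (c j)) js) (1\<^sub>m 2) = rot_z (\<Sum>j\<leftarrow>js. c j)"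
  by (induction js) (simp_all add: rot_z_0 rot_z_mult)

text \<open>Diagonal gates compose by adding angles, so the order of the coordinates disappears and
  a single rotation by the affine phase remains.\<close>

lemma gate_U1_eq: "gate_U1 a b x = hadamard * rot_z (- (b + inner a x)) * hadamard"
proof -
  have "(\<Sum>j\<leftarrow>rev (sorted_list_of_set UNIV). - (vec_nth a j * vec_nth x j)) = - inner a x"
    by (simp add: inner_vec_def sum_list_distinct_conv_sum_set sum_negf)
  then show ?thesis
    unfolding gate_U1_def foldr_rot_z
    by (simp add: assoc_mult_mat[of hadamard 2 2 _ 2 _ 2] rot_z_mult add.commute)
qed

lemma gate_U1_carrier[simp]: "gate_U1 a b x \<in> carrier_mat 2 2"
  unfolding gate_U1_eq by (intro mult_carrier_mat[of _ 2 2 _ 2] gate_carrier)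

text \<open>Conjugation by the Hadamard gate turns a rotation about the z axis into one about the x
  axis. The first column suffices because the prepared state occupies only the first position of
  each block.\<close>

lemma gate_U1_index:
  "gate_U1 a b x $$ (0, 0) = of_real (cos ((b + inner a x) / 2))"
  "gate_U1 a b x $$ (Suc 0, 0) = \<i> * of_real (sin ((b + inner a x) / 2))"
proof -
  have c: "hadamard * rot_z \<alpha> \<in> carrier_mat 2 2" for \<alpha>
    by (intro mult_carrier_mat[of _ 2 2 _ 2] gate_carrier)
  define s where "s = complex_of_real (1 / sqrt 2)"
  note H = hadamard_index[folded s_def]
  have ss: "s * s = 1 / 2"
    unfolding s_def of_real_mult[symmetric] by simp
  define \<alpha> where "\<alpha> = b + inner a x"
  have "gate_U1 a b x $$ (0, 0) = (s * s) * (cis (\<alpha> / 2) + cis (- (\<alpha> / 2)))"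
    unfolding gate_U1_eq \<alpha>_def[symmetric]
    by (simp add: mult_mat2_index[OF c] mult_mat2_index H rot_z_index distrib_left mult_ac)
  then show "gate_U1 a b x $$ (0, 0) = of_real (cos ((b + inner a x) / 2))"
    unfolding ss \<alpha>_def[symmetric] by (simp add: complex_eq_iff)
  have "gate_U1 a b x $$ (Suc 0, 0) = (s * s) * (cis (\<alpha> / 2) - cis (- (\<alpha> / 2)))"
    unfolding gate_U1_eq \<alpha>_def[symmetric]
    by (simp add: mult_mat2_index[OF c] mult_mat2_index H rot_z_index right_diff_distrib mult_ac)
  then show "gate_U1 a b x $$ (Suc 0, 0) = \<i> * of_real (sin ((b + inner a x) / 2))"
    unfolding ss \<alpha>_def[symmetric] by (simp add: complex_eq_iff)
qed

lemma block_U_carrier: "block_U x p \<in> carrier_mat 4 4"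
  by (cases p, rule carrier_matI)
    (simp_all add: block_U_def kronecker_def carrier_matD[OF gate_U1_carrier] carrier_matD[OF gate_carrier(2)])

text \<open>Rows 1 and 2 are the outcomes 01 and 10, in which exactly one of the two qubits is
  flipped; these are the outcomes counted by the network.\<close>

lemma block_U_index:
  "block_U x (a, b, \<gamma>) $$ (Suc 0, 0) = of_real (cos ((b + inner a x) / 2)) * of_real (sin (\<gamma> / 2))"
  "block_U x (a, b, \<gamma>) $$ (2, 0) = \<i> * of_real (sin ((b + inner a x) / 2)) * of_real (cos (\<gamma> / 2))"
  by (simp_all add: block_U_def kronecker_def rot_y_index gate_U1_index
      carrier_matD[OF gate_U1_carrier] carrier_matD[OF gate_carrier(2)])

section \<open>Entries and amplitudes of the whole circuit\<close>

lemma diag_block_mat_carrier4: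
  assumes "set As \<subseteq> carrier_mat 4 4" and "B \<in> carrier_mat p p"
  shows "diag_block_mat (As @ [B]) \<in> carrier_mat (4 * length As + p) (4 * length As + p)"
proof -
  have "sum_list (map dim_row As) = 4 * length As" "sum_list (map dim_col As) = 4 * length As"
    using assms(1) by (induction As) auto
  then show ?thesis
    using carrier_matD[OF assms(2)] by (intro carrier_matI) (simp_all add: dim_diag_block_mat)
qed

text \<open>Induction on the list: removing the leading block lowers both block indices by one, that
  is, both matrix indices by 4. Keeping the padding block \<open>B\<close> outside the list leaves
  all listed blocks of size 4.\<close>

lemma diag_block_mat_index4:
  fixes As :: "'a::zero mat list"
  assumes "set As \<subseteq> carrier_mat 4 4" and "B \<in> carrier_mat p p"
    and "i < length As" and "j < length As" and "m < 4" and "l < 4"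
  shows "diag_block_mat (As @ [B]) $$ (4 * i + m, 4 * j + l) = (if i = j then (As ! i) $$ (m, l) else 0)"
  using assms(1,3,4)
proof (induction As arbitrary: i j)
  case Nil
  then show ?case by simp
next
  case (Cons A As)
  let ?D = "diag_block_mat (As @ [B])"
  let ?n = "4 * length As + p"
  have A: "A \<in> carrier_mat 4 4" and As: "set As \<subseteq> carrier_mat 4 4"
    using Cons.prems(1) by simp_all
  note dims = carrier_matD[OF A] carrier_matD[OF diag_block_mat_carrier4[OF As assms(2)]]
  have "diag_block_mat ((A # As) @ [B]) = four_block_mat A (0\<^sub>m 4 ?n) (0\<^sub>m ?n 4) ?D"
    by (simp only: append_Cons diag_block_mat.simps(2) Let_def dims)
  moreover have "4 * i + m < 4 + ?n" "4 * j + l < 4 + ?n"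
    using Cons.prems(2,3) assms(5,6) by simp_all
  ultimately have F: "diag_block_mat ((A # As) @ [B]) $$ (4 * i + m, 4 * j + l) =
      (if 4 * i + m < 4 then if 4 * j + l < 4 then A $$ (4 * i + m, 4 * j + l)
         else 0\<^sub>m 4 ?n $$ (4 * i + m, 4 * j + l - 4)
       else if 4 * j + l < 4 then 0\<^sub>m ?n 4 $$ (4 * i + m - 4, 4 * j + l)
         else ?D $$ (4 * i + m - 4, 4 * j + l - 4))"
    by (simp only: index_mat_four_block(1) dims)
  show ?case
  proof (cases i)
    case 0
    show ?thesis
      unfolding F using 0 Cons.prems(3) assms(5,6) by (cases j) simp_all
  next
    case i: (Suc i')
    show ?thesis
    proof (cases j)
      case 0
      show ?thesis
        unfolding F using i 0 Cons.prems(2) assms(5,6) by simp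
    next
      case j: (Suc j')
      have "?D $$ (4 * i' + m, 4 * j' + l) = (if i' = j' then (As ! i') $$ (m, l) else 0)"
        using Cons.prems(2,3) i j by (intro Cons.IH As) simp_all
      moreover have "4 * i + m - 4 = 4 * i' + m" "4 * j + l - 4 = 4 * j' + l" "\<not> 4 * i + m < 4" "\<not> 4 * j + l < 4"
        using i j by simp_all
      ultimately show ?thesis
        unfolding F by (simp only: if_False i j nth_Cons_Suc nat.inject)
    qed
  qed
qed

lemma map_block_U_carrier: "set (map (block_U x) \<theta>) \<subseteq> carrier_mat 4 4"
  using block_U_carrier by auto

lemma circuit_U_carrier: "circuit_U \<theta> x \<in> carrier_mat (qdim (length \<theta>)) (qdim (length \<theta>))"
  using diag_block_mat_carrier4[OF map_block_U_carrier one_carrier_mat[of "pad (length \<theta>)"]]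
  by (simp add: circuit_U_def qdim_def)

lemma circuit_U_index:
  assumes "i < length \<theta>" "j < length \<theta>" "m < 4"
  shows "circuit_U \<theta> x $$ (4 * i + m, 4 * j) = (if i = j then block_U x (\<theta> ! i) $$ (m, 0) else 0)"
  using diag_block_mat_index4[OF map_block_U_carrier one_carrier_mat[of "pad (length \<theta>)"], of i x \<theta> j m 0] assms
  by (simp add: circuit_U_def)

lemma psi_index:
  assumes "k < qdim n"
  shows "vec_index (psi n) k = of_real (1 / sqrt (real n)) * (\<Sum>j<n. if k = 4 * j then 1 else 0)"
proof -
  have "vec_index (ket (qdim n) (4 * j)) k = (if k = 4 * j then 1 else 0)" if "j < n" for j
    using that assms by (subst index_unit_vec(1)) (simp_all add: qdim_def)
  then have "(\<Sum>j<n. vec_index (ket (qdim n) (4 * j)) k) = (\<Sum>j<n. if k = 4 * j then 1 else 0)"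
    by (intro sum.cong) simp_all
  then show ?thesis
    unfolding psi_def using assms by (simp only: index_smult_vec dim_vec index_vec)
qed

text \<open>Associativity lets \<open>V\<close> act on the initial state first, producing
  \<open>psi n\<close>. Its support 4 j selects first columns of blocks, and block diagonality
  leaves only the block j = i.\<close>

lemma circuit_amplitude:
  assumes V: "preparation n V" and \<theta>: "length \<theta> = n" and i: "i < n" and m: "m < 4"
  shows "((circuit_U \<theta> x * V) *\<^sub>v ket (qdim n) 0) \<bullet>c ket (qdim n) (4 * i + m)
    = of_real (1 / sqrt (real n)) * block_U x (\<theta> ! i) $$ (m, 0)"
proof -
  let ?N = "qdim n" and ?k = "4 * i + m" and ?U = "circuit_U \<theta> x" and ?c = "complex_of_real (1 / sqrt (real n))"
  have U: "?U \<in> carrier_mat ?N ?N"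
    using circuit_U_carrier[of \<theta> x] unfolding \<theta> .
  have k: "?k < ?N"
    using i m by (simp add: qdim_def)
  have lt: "4 * j < ?N" if "j < n" for j
    using that by (simp add: qdim_def)
  have Vc: "V \<in> carrier_mat ?N ?N" and Vpsi: "V *\<^sub>v ket ?N 0 = psi n"
    using V unfolding preparation_def unitary_mat_def by blast+
  have psi: "psi n \<in> carrier_vec ?N"
    unfolding psi_def by (intro smult_carrier_vec[THEN iffD2] vec_carrier)
  have ket: "conjugate (ket ?N ?k) = ket ?N ?k"
    by (rule eq_vecI) (simp_all add: unit_vec_def)
  have "((?U * V) *\<^sub>v ket ?N 0) \<bullet>c ket ?N ?k = vec_index (?U *\<^sub>v psi n) ?k"
    unfolding assoc_mult_mat_vec[OF U Vc unit_vec_carrier] Vpsi ket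
    by (rule scalar_prod_right_unit[OF k])
  also have "\<dots> = (\<Sum>k'<?N. ?U $$ (?k, k') * vec_index (psi n) k')"
    unfolding lessThan_atLeast0 using k
    by (simp only: index_mult_mat_vec carrier_matD[OF U] scalar_prod_def carrier_vecD[OF psi])
      (intro sum.cong refl, simp add: carrier_matD[OF U])
  also have "\<dots> = (\<Sum>k'<?N. \<Sum>j<n. if k' = 4 * j then ?c * ?U $$ (?k, 4 * j) else 0)"
  proof (rule sum.cong[OF refl])
    fix k' assume "k' \<in> {..<?N}"
    then have "?U $$ (?k, k') * vec_index (psi n) k' = (\<Sum>j<n. ?U $$ (?k, k') * (?c * (if k' = 4 * j then 1 else 0)))"
      by (simp only: psi_index lessThan_iff sum_distrib_left)
    also have "\<dots> = (\<Sum>j<n. if k' = 4 * j then ?c * ?U $$ (?k, 4 * j) else 0)"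
      by (rule sum.cong[OF refl]) (simp only: if_distrib mult_1_right mult_zero_right mult.commute split: if_split, simp)
    finally show "?U $$ (?k, k') * vec_index (psi n) k' = (\<Sum>j<n. if k' = 4 * j then ?c * ?U $$ (?k, 4 * j) else 0)" .
  qed
  also have "\<dots> = (\<Sum>j<n. \<Sum>k'<?N. if k' = 4 * j then ?c * ?U $$ (?k, 4 * j) else 0)"
    by (rule sum.swap)
  also have "\<dots> = (\<Sum>j<n. ?c * ?U $$ (?k, 4 * j))"
    using lt by (intro sum.cong refl) (simp only: sum.delta finite_lessThan lessThan_iff if_True)
  also have "\<dots> = (\<Sum>j<n. if j = i then ?c * block_U x (\<theta> ! i) $$ (m, 0) else 0)"
  proof (rule sum.cong[OF refl])
    fix j assume "j \<in> {..<n}"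
    then have "?U $$ (?k, 4 * j) = (if i = j then block_U x (\<theta> ! i) $$ (m, 0) else 0)"
      using i m \<theta> by (intro circuit_U_index) simp_all
    then show "?c * ?U $$ (?k, 4 * j) = (if j = i then ?c * block_U x (\<theta> ! i) $$ (m, 0) else 0)"
      by simp
  qed
  also have "\<dots> = ?c * block_U x (\<theta> ! i) $$ (m, 0)"
    using i by (simp only: sum.delta finite_lessThan lessThan_iff if_True)
  finally show ?thesis .
qed

text \<open>In block i the two qubits behave like independent coins that stay unflipped with
  probabilities p = cos^2 (u / 2) and q = cos^2 (\<gamma> / 2), where u is the affine phase. Exactly
  one flips with probability (1 - (2 p - 1) (2 q - 1)) / 2, and the double-angle formula makes the
  product cos u cos \<gamma>. The map P \<mapsto> R - 2 R P removes the offset.\<close>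

lemma qnn_eq:
  assumes V: "preparation n V" and \<theta>: "length \<theta> = n" and n: "n \<ge> 1"
  shows "qnn R n V \<theta> x = R / real n * (\<Sum>(a, b, \<gamma>)\<leftarrow>\<theta>. cos \<gamma> * cos (b + inner a x))"
proof -
  have p: "prob n V \<theta> x m = (\<Sum>i<n. (cmod (block_U x (\<theta> ! i) $$ (m, 0)))\<^sup>2) / real n" if "m < 4" for m
    unfolding prob_def using n
    by (simp add: circuit_amplitude[OF V \<theta> _ that] norm_mult power_mult_distrib norm_divide power_divide sum_divide_distrib)
  have half: "(cos (u / 2))\<^sup>2 * (sin (v / 2))\<^sup>2 + (sin (u / 2))\<^sup>2 * (cos (v / 2))\<^sup>2 = (1 - cos v * cos u) / 2" for u v :: real
  proof -
    have "cos u = 2 * (cos (u / 2))\<^sup>2 - 1" "cos v = 2 * (cos (v / 2))\<^sup>2 - 1"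
      using cos_double_cos[of "u / 2"] cos_double_cos[of "v / 2"] by simp_all
    moreover have "p * (1 - q) + (1 - p) * q = (1 - (2 * q - 1) * (2 * p - 1)) / 2" for p q :: real
      by (simp add: field_simps)
    ultimately show ?thesis
      unfolding sin_squared_eq by (simp only:)
  qed
  have b: "(cmod (block_U x q $$ (Suc 0, 0)))\<^sup>2 + (cmod (block_U x q $$ (2, 0)))\<^sup>2 =
      (1 - (case q of (a, b, \<gamma>) \<Rightarrow> cos \<gamma> * cos (b + inner a x))) / 2" for q
  proof (cases q)
    case (fields a b \<gamma>)
    show ?thesis
      unfolding fields block_U_index norm_mult norm_of_real norm_ii mult_1 power_mult_distrib power2_abs half by simp
  qed
  have "prob n V \<theta> x 1 + prob n V \<theta> x 2 =
      (\<Sum>i<n. (1 - (case \<theta> ! i of (a, b, \<gamma>) \<Rightarrow> cos \<gamma> * cos (b + inner a x))) / 2) / real n"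
    unfolding b[symmetric] by (simp add: p sum.distrib add_divide_distrib)
  also have "\<dots> = (real n - (\<Sum>i<n. case \<theta> ! i of (a, b, \<gamma>) \<Rightarrow> cos \<gamma> * cos (b + inner a x))) / (2 * real n)"
    by (simp add: sum_subtractf sum_divide_distrib[symmetric])
  also have "(\<Sum>i<n. case \<theta> ! i of (a, b, \<gamma>) \<Rightarrow> cos \<gamma> * cos (b + inner a x)) = (\<Sum>(a, b, \<gamma>)\<leftarrow>\<theta>. cos \<gamma> * cos (b + inner a x))"
    using \<theta> by (simp add: sum_list_sum_nth lessThan_atLeast0)
  finally have e: "prob n V \<theta> x 1 + prob n V \<theta> x 2 =
      (real n - (\<Sum>(a, b, \<gamma>)\<leftarrow>\<theta>. cos \<gamma> * cos (b + inner a x))) / (2 * real n)" .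
  show ?thesis
    unfolding qnn_def e using n by (simp add: field_simps)
qed

section \<open>The approximation theorem\<close>

lemma fourier_eq_cis:
  "fourier f \<xi> = (LINT y|lborel. cis (- (2 * pi * inner y \<xi>)) * of_real (f y))"
  by (simp add: fourier_def cis_conv_exp mult_ac)

lemma borel_measurable_fourier:
  assumes [measurable]: "f \<in> borel_measurable borel"
  shows "fourier f \<in> borel_measurable borel"
proof -
  have "(\<lambda>\<xi>. LINT y|lborel. cis (- (2 * pi * inner y \<xi>)) * of_real (f y)) \<in> borel_measurable borel"
    unfolding cis_conv_exp by measurable
  then show ?thesis
    by (simp add: fourier_eq_cis[abs_def])
qed

lemma norm_cbox_le:
  fixes x :: "real ^ 'd"
  assumes "x \<in> cbox (\<chi> j. - M) (\<chi> j. M)"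
  shows "norm x \<le> M * sqrt (real CARD('d))"
proof -
  have le: "\<bar>vec_nth x i\<bar> \<le> M" for i
    using assms by (auto simp: mem_box_cart abs_le_iff minus_le_iff)
  then have M: "M \<ge> 0"
    using abs_ge_zero order_trans by blast
  have "norm x = sqrt (\<Sum>i\<in>UNIV. (vec_nth x i)\<^sup>2)"
    by (simp add: norm_vec_def L2_set_def)
  also have "\<dots> \<le> sqrt (\<Sum>i\<in>(UNIV :: 'd set). M\<^sup>2)"
    using le M by (intro real_sqrt_le_mono sum_mono) (simp add: abs_le_square_iff[symmetric])
  also have "\<dots> = M * sqrt (real CARD('d))"
    using M by (simp add: real_sqrt_mult)
  finally show ?thesis .
qed

lemma qnn_approximation:
  fixes f :: "real ^ 'd::{finite,linorder} \<Rightarrow> real"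
  assumes R: "R > 0" and M: "M > 0" and f: "f \<in> barron_class R" and n: "n \<ge> 1" and V: "preparation n V"
  shows "\<exists>\<theta>\<in>Theta n. \<forall>x\<in>cbox (\<chi> j. - M) (\<chi> j. M). \<bar>f x - qnn R n V \<theta> x\<bar> \<le>
    (fourier_L1 f + 8 * pi * M * sqrt (real CARD('d)) * sqrt (fourier_L1 f) * norm_B2 f) / sqrt (real n)"
proof -
  define L where "L = fourier_L1 f"
  define F where "F = fourier f"
  have cont: "continuous_on UNIV f" and fint: "integrable lborel f" and F1: "integrable lborel (\<lambda>\<xi>. cmod (F \<xi>))"
    and LR: "L \<le> R" and F2: "integrable lborel (\<lambda>\<xi>. (norm \<xi>)\<^sup>2 * cmod (F \<xi>))"
    using f unfolding barron_class_def L_def F_def by auto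
  have L: "L = (LINT \<xi>|lborel. cmod (F \<xi>))"
    by (simp add: L_def F_def fourier_L1_def)
  have L0: "L \<ge> 0"
    unfolding L by simp
  have [measurable]: "f \<in> borel_measurable borel"
    using fint by auto
  have [measurable]: "F \<in> borel_measurable borel"
    unfolding F_def by (rule borel_measurable_fourier) measurable
  have Fint: "integrable lborel F"
    using F1 by (simp add: integrable_norm_iff)
  have inv: "(LINT \<xi>|lborel. cis (2 * pi * inner x \<xi>) * F \<xi>) = of_real (f x)" for x
    using fourier_inversion[OF fint, of x] cont Fint
    by (simp add: F_def fourier_eq_cis[abs_def] continuous_on_eq_continuous_at)
  have inv_int: "integrable lborel (\<lambda>\<xi>. cis (2 * pi * inner x \<xi>) * F \<xi>)" for x
    by (rule Bochner_Integration.integrable_bound[OF Fint]) (auto simp: norm_mult cis_conv_exp)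
  have inv_Re: "(LINT \<xi>|lborel. Re (cis (2 * pi * inner x \<xi>) * F \<xi>)) = f x" for x
    using integral_Re[OF inv_int[of x]] inv[of x] by simp
  show ?thesis
  proof (cases "L = 0")
    \<comment> \<open>With L = 0 there is no density to normalise. Inversion then gives f = 0, and
      the angle pi / 2 has cosine 0, so the network vanishes identically.\<close>
    case True
    have "AE \<xi> in lborel. cmod (F \<xi>) = 0"
      using integral_nonneg_eq_0_iff_AE[OF F1] True L by simp
    then have "AE \<xi> in lborel. Re (cis (2 * pi * inner x \<xi>) * F \<xi>) = 0" for x
      by eventually_elim simp
    then have f0: "f x = 0" for x
      unfolding inv_Re[of x, symmetric] by (rule integral_eq_zero_AE)
    define \<theta> :: "'d param" where "\<theta> = replicate n (0, 0, pi / 2)"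
    have "\<theta> \<in> Theta n"
      using n pi_gt_zero by (simp add: \<theta>_def Theta_def)
    moreover have "qnn R n V \<theta> x = 0" for x
      by (subst qnn_eq[OF V _ n]) (simp_all add: \<theta>_def sum_list_replicate)
    moreover have "norm_B2 f \<ge> 0"
      by (simp add: norm_B2_def)
    ultimately show ?thesis
      using f0 True by (intro bexI[of _ \<theta>]) (auto simp: L_def)
  next
    case False
    with L0 have L: "L > 0" by simp
    note L_eq = \<open>L = (LINT \<xi>|lborel. cmod (F \<xi>))\<close>
    define p where "p = (\<lambda>\<xi>. cmod (F \<xi>) / L)"
    have [measurable]: "p \<in> borel_measurable borel"
      unfolding p_def by measurable
    have p0: "p \<xi> \<ge> 0" for \<xi>
      using L by (simp add: p_def)
    define N where "N = density lborel (\<lambda>\<xi>. ennreal (p \<xi>))"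
    define X where "X = (\<lambda>\<xi>::real ^ 'd::{finite,linorder}. (2 * pi) *\<^sub>R \<xi>)"
    \<comment> \<open>The value 1 at zeros of \<open>F\<close> keeps the modulus equal to 1
      everywhere; the density vanishes at these points.\<close>
    define U where "U = (\<lambda>\<xi>. if F \<xi> = 0 then 1 else F \<xi> / of_real (cmod (F \<xi>)))"
    define D where "D = (cbox (\<chi> j. - M) (\<chi> j. M) :: (real ^ 'd::{finite,linorder}) set)"
    define r where "r = M * sqrt (real CARD('d))"
    have [measurable]: "X \<in> borel_measurable borel" "U \<in> borel_measurable borel"
      unfolding X_def U_def by measurable
    have U_norm: "cmod (U \<xi>) = 1" for \<xi>
      by (simp add: U_def norm_divide)
    have UF: "p \<xi> * Re (U \<xi> * z) = Re (z * F \<xi>) / L" for \<xi> z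
    proof (cases "F \<xi> = 0")
      case False
      then have "of_real (cmod (F \<xi>)) * (U \<xi> * z) = z * F \<xi>"
        by (simp add: U_def)
      moreover have "Re (of_real a * w) = a * Re w" for a w
        by simp
      ultimately have "cmod (F \<xi>) * Re (U \<xi> * z) = Re (z * F \<xi>)"
        by metis
      then show ?thesis
        by (simp only: p_def times_divide_eq_left)
    qed (simp add: p_def)
    have pX: "p \<xi> * (norm (X \<xi>))\<^sup>2 = 4 * pi\<^sup>2 / L * ((norm \<xi>)\<^sup>2 * cmod (F \<xi>))" for \<xi>
      by (simp add: p_def X_def power_mult_distrib)
    interpret N: prob_space N
    proof (rule prob_spaceI)
      have "emeasure N (space N) = (\<integral>\<^sup>+ \<xi>. ennreal (p \<xi>) \<partial>lborel)"
        by (simp add: N_def emeasure_density)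
      also have "\<dots> = ennreal (LINT \<xi>|lborel. p \<xi>)"
        using F1 p0 by (intro nn_integral_eq_integral) (auto simp: p_def)
      also have "(LINT \<xi>|lborel. p \<xi>) = 1"
        using L by (simp add: p_def L_eq[symmetric])
      finally show "emeasure N (space N) = 1" by simp
    qed
    interpret W: random_waves N X U D r
    proof
      show "X \<in> borel_measurable N" "U \<in> borel_measurable N"
        by (simp_all add: N_def)
      show "integrable N (\<lambda>\<xi>. (norm (X \<xi>))\<^sup>2)"
        unfolding N_def using F2 p0
        by (subst integrable_density) (simp_all add: pX)
      show "0 \<in> D"
        using M by (simp add: D_def mem_box_cart)
      show "norm x \<le> r" if "x \<in> D" for x
        using norm_cbox_le that unfolding D_def r_def by blast
    qed (rule U_norm)
    have mean: "W.mean x = f x / L" for x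
    proof -
      have "W.mean x = (LINT \<xi>|lborel. p \<xi> * Re (U \<xi> * cis (inner x (X \<xi>))))"
      proof -
        have "(\<lambda>\<xi>. Re (U \<xi> * cis (inner x (X \<xi>)))) \<in> borel_measurable lborel"
          unfolding cis_conv_exp by measurable
        then show ?thesis
          unfolding W.mean_def W.wave_def unfolding N_def using p0
          by (subst integral_density) (simp_all del: times_complex.sel)
      qed
      also have "\<dots> = (LINT \<xi>|lborel. Re (cis (2 * pi * inner x \<xi>) * F \<xi>) / L)"
        unfolding UF by (simp add: X_def)
      also have "\<dots> = f x / L"
        unfolding integral_divide_zero inv_Re ..
      finally show ?thesis .
    qed
    have "W.second_moment = (LINT \<xi>|lborel. p \<xi> * (norm (X \<xi>))\<^sup>2)"
      unfolding W.second_moment_def unfolding N_def using p0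
      by (subst integral_density) simp_all
    also have "\<dots> = 4 * pi\<^sup>2 / L * (LINT \<xi>|lborel. (norm \<xi>)\<^sup>2 * cmod (F \<xi>))"
      unfolding pX by (rule integral_mult_right_zero)
    \<comment> \<open>\<open>norm_B2 f\<close> is the root of the unnormalised second moment:
      normalising the density divides by L, and the scaling in \<open>X\<close> contributes 2
      pi.\<close>
    finally have sm: "sqrt W.second_moment = 2 * pi / sqrt L * norm_B2 f"
      using L by (simp add: norm_B2_def F_def real_sqrt_mult real_sqrt_divide)
    obtain \<xi>s where len: "length \<xi>s = n" and \<xi>s: "\<And>x. x \<in> D \<Longrightarrow> \<bar>(\<Sum>\<xi>\<leftarrow>\<xi>s. W.wave \<xi> x) - real n * (f x / L)\<bar>
        \<le> sqrt (real n) * (1 + 4 * r * sqrt W.second_moment)"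
      using W.exists_sample[of n] unfolding mean by blast
    \<comment> \<open>Frequency and phase reproduce the sampled wave, and the common angle has
      cosine L / R. Since \<open>arccos\<close> takes values between 0 and pi, the angle is
      admissible.\<close>
    define \<theta> :: "'d param" where "\<theta> = map (\<lambda>\<xi>. (X \<xi>, Arg (U \<xi>), arccos (L / R))) \<xi>s"
    have LR1: "- 1 \<le> L / R" "L / R \<le> 1"
      using L R LR by (auto simp: divide_simps)
    have "\<theta> \<in> Theta n"
      using len arccos_lbound[OF LR1] arccos_ubound[OF LR1] pi_gt_zero
      by (auto simp: \<theta>_def Theta_def)
    moreover have "\<bar>f x - qnn R n V \<theta> x\<bar> \<le>
      (L + 8 * pi * M * sqrt (real CARD('d)) * sqrt L * norm_B2 f) / sqrt (real n)" if x: "x \<in> D" for x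
    proof -
      have wave: "cos (Arg (U \<xi>) + inner (X \<xi>) x) = W.wave \<xi> x" for \<xi>
      proof -
        have "U \<xi> \<noteq> 0"
          using U_norm[of \<xi>] by auto
        then have "cis (Arg (U \<xi>)) = U \<xi>"
          using U_norm[of \<xi>] by (simp add: cis_Arg sgn_div_norm)
        then have "W.wave \<xi> x = Re (cis (Arg (U \<xi>)) * cis (inner x (X \<xi>)))"
          by (simp add: W.wave_def)
        then show ?thesis
          unfolding cis_mult by (simp add: inner_commute)
      qed
      have "qnn R n V \<theta> x = R / real n * (\<Sum>\<xi>\<leftarrow>\<xi>s. L / R * W.wave \<xi> x)"
        using len by (subst qnn_eq[OF V _ n]) (simp_all add: \<theta>_def comp_def wave cos_arccos[OF LR1])
      also have "\<dots> = L / real n * (\<Sum>\<xi>\<leftarrow>\<xi>s. W.wave \<xi> x)"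
        unfolding sum_list_const_mult using R by simp
      finally have "f x - qnn R n V \<theta> x = - (L / real n * ((\<Sum>\<xi>\<leftarrow>\<xi>s. W.wave \<xi> x) - real n * (f x / L)))"
        using L n by (simp add: field_simps)
      then have "\<bar>f x - qnn R n V \<theta> x\<bar> = L / real n * \<bar>(\<Sum>\<xi>\<leftarrow>\<xi>s. W.wave \<xi> x) - real n * (f x / L)\<bar>"
        using L by (simp add: abs_mult)
      also have "\<dots> \<le> L / real n * (sqrt (real n) * (1 + 4 * r * sqrt W.second_moment))"
        using L \<xi>s[OF x] by (intro mult_left_mono) auto
      also have "\<dots> = (sqrt (real n) / real n) * (L * (1 + 4 * r * sqrt W.second_moment))"
        by simp
      also have "sqrt (real n) / real n = 1 / sqrt (real n)"
        using n by (simp add: frac_eq_eq)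
      also have "L * (1 + 4 * r * sqrt W.second_moment) = L + 8 * pi * r * (L / sqrt L) * norm_B2 f"
        unfolding sm by (simp add: algebra_simps)
      also have "L / sqrt L = sqrt L"
        using L by (simp add: real_div_sqrt)
      finally show ?thesis
        by (simp add: r_def mult_ac)
    qed
    ultimately show ?thesis
      unfolding L_def D_def by blast
  qed
qed

text \<open>In \<open>ereal\<close> the supremum is a least upper bound with no boundedness
  condition, so the pointwise estimate gives the claim; 1 \<le> 2 (pi + 1) passes to the stated
  constant.\<close>

theorem mainTheorem5:
  fixes R M :: real and f :: "real ^ 'd::{finite,linorder} \<Rightarrow> real"
    and n :: nat and V :: "complex mat"
  assumes "R > 0" and "M > 0"
    and "f \<in> barron_class R"
    and "n \<ge> 1"
    and "preparation n V"
  shows "\<exists>\<theta> \<in> Theta n.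
    (SUP x \<in> cbox (\<chi> j. - M) (\<chi> j. M). ereal \<bar>f x - qnn R n V \<theta> x\<bar>)
      \<le> ereal ((2 * (pi + 1) * fourier_L1 f
           + 8 * pi * M * sqrt (real CARD('d)) * sqrt (fourier_L1 f) * norm_B2 f) / sqrt (real n))"
proof -
  obtain \<theta> where \<theta>: "\<theta> \<in> Theta n" and le: "\<And>x. x \<in> cbox (\<chi> j. - M) (\<chi> j. M) \<Longrightarrow> \<bar>f x - qnn R n V \<theta> x\<bar> \<le>
      (fourier_L1 f + 8 * pi * M * sqrt (real CARD('d)) * sqrt (fourier_L1 f) * norm_B2 f) / sqrt (real n)"
    using qnn_approximation[OF assms] by blast
  have "fourier_L1 f \<ge> 0"
    by (simp add: fourier_L1_def)
  then have "1 * fourier_L1 f \<le> 2 * (pi + 1) * fourier_L1 f"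
    using pi_gt_zero by (intro mult_right_mono) auto
  then have "(fourier_L1 f + 8 * pi * M * sqrt (real CARD('d)) * sqrt (fourier_L1 f) * norm_B2 f) / sqrt (real n)
    \<le> (2 * (pi + 1) * fourier_L1 f + 8 * pi * M * sqrt (real CARD('d)) * sqrt (fourier_L1 f) * norm_B2 f) / sqrt (real n)"
    by (intro divide_right_mono) auto
  then show ?thesis
    using \<theta> le by (intro bexI[of _ \<theta>] SUP_least) (auto intro: order_trans)
qed

end
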